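(* Let $G_1$ be a connected graph on $m\geq 2$ vertices, and let $H_1=\bigsqcup_{i=1}^r H_{1i}$ and $H_2=\bigsqcup_{i=1}^s H_{2i}$ be two graphs on $[n_1]=\bigcup_{i=1}^r[n_{1i}]$ and $[n_2]=\bigcup_{i=1}^s[n_{2i}]$, respectively, where $r,s\geq 2$, the $H_{1i}$ (on $[n_{1i}]$) are the connected components of $H_1$ and the $H_{2i}$ (on $[n_{2i}]$) are the connected components of $H_2$. If $G_2:=H_1*H_2$, and $n_{1i},n_{2j}\geq m$ for all $i=1,\ldots,r$ and $j=1,\ldots,s$, then $J_{G_1,G_2}$ is not unmixed, and hence $S/J_{G_1,G_2}$ is not Cohen-Macaulay.
   Context: Graphs are finite simple graphs, $K$ is a field; $[n]$ denotes a vertex set with $n$ elements. The join $G*H$ of graphs $G$ and $H$ on disjoint vertex sets is the graph with vertex set $V(G)\cup V(H)$ and edge set $E(G)\cup E(H)\cup\{\{v,w\}: v\in V(G), w\in V(H)\}$. For graphs $G_1$ on $[m]$ and $G_2$ on $[n]$, let $X=(x_{ij})$ be an $m\times n$ matrix of indeterminates and $S=K[X]$. For edges $e=\{i,j\}$ of $G_1$ ($i<j$) and $f=\{t,l\}$ of $G_2$ ($t<l$) put $p_{e,f}=x_{it}x_{jl}-x_{il}x_{jt}$. The binomial edge ideal of the pair $(G_1,G_2)$ is $J_{G_1,G_2}=(p_{e,f}: e\in E(G_1), f\in E(G_2))\subset S$. *)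

theory Defs
  imports
    "HOL-Library.Poly_Mapping"
    "HOL-Library.Extended_Nat"
    "HOL-Algebra.QuotRing"
    "HOL-Algebra.Ring_Divisibility"
    "Graph_Theory.Graph_Theory"
begin

text \<open>
  Finite simple graphs are the symmetric loop-free digraphs of the locale \<^locale>\<open>pair_graph\<close>:
  an edge \<open>{i, j}\<close> is the pair of arcs \<open>(i, j)\<close>, \<open>(j, i)\<close>. For such a graph the elements of
  \<^const>\<open>pre_digraph.sccs\<close> are its connected components.
\<close>

definition graph_join ::
    "'b pair_pre_digraph \<Rightarrow> 'b pair_pre_digraph \<Rightarrow> 'b pair_pre_digraph" where
  "graph_join G H =
    \<lparr> pverts = pverts G \<union> pverts H,
      parcs = parcs G \<union> parcs H \<union> pverts G \<times> pverts H \<union> pverts H \<times> pverts G \<rparr>"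


text \<open>
  The variable \<open>x\<^sub>i\<^sub>t\<close> has index \<open>(i, t)\<close>; a monomial is its finitely supported exponent function.
  The type contains a variable for every pair of type \<^typ>\<open>'a \<times> 'b\<close>, and the carrier below
  restricts to those indexed by \<open>V \<times> W\<close>.
\<close>

type_synonym ('a, 'b, 'k) matrix_poly = "(('a \<times> 'b) \<Rightarrow>\<^sub>0 nat) \<Rightarrow>\<^sub>0 'k"

definition matrix_poly_ring :: "'a set \<Rightarrow> 'b set \<Rightarrow> ('a, 'b, 'k::field) matrix_poly ring" where
  "matrix_poly_ring V W =
    \<lparr> carrier = {p. \<forall>m \<in> Poly_Mapping.keys p. Poly_Mapping.keys m \<subseteq> V \<times> W},
      monoid.mult = (*), one = 1, ring.zero = 0, add = (+) \<rparr>"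

definition matrix_var :: "'a \<Rightarrow> 'b \<Rightarrow> ('a, 'b, 'k::field) matrix_poly" where
  "matrix_var i t = Poly_Mapping.single (Poly_Mapping.single (i, t) 1) 1"

definition binomial_edge_ideal ::
    "'a::linorder pair_pre_digraph \<Rightarrow> 'b::linorder pair_pre_digraph
      \<Rightarrow> ('a, 'b, 'k::field) matrix_poly set" where
  "binomial_edge_ideal G\<^sub>1 G\<^sub>2 =
    genideal (matrix_poly_ring (pverts G\<^sub>1) (pverts G\<^sub>2))
      {matrix_var i t * matrix_var j l - matrix_var i l * matrix_var j t | i j t l.
        (i, j) \<in> parcs G\<^sub>1 \<and> i < j \<and> (t, l) \<in> parcs G\<^sub>2 \<and> t < l}"


definition prime_height :: "('r, 'm) ring_scheme \<Rightarrow> 'r set \<Rightarrow> enat" where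
  "prime_height R P =
    Sup {enat n | n. \<exists>Q :: nat \<Rightarrow> 'r set.
      (\<forall>i \<le> n. primeideal (Q i) R) \<and> (\<forall>i < n. Q i \<subset> Q (Suc i)) \<and> Q n = P}"

text \<open>The associated primes of the \<open>R\<close>-module \<open>R/I\<close>: the primes of the form \<open>(I : f)\<close>.\<close>

definition associated_primes :: "('r, 'm) ring_scheme \<Rightarrow> 'r set \<Rightarrow> 'r set set" where
  "associated_primes R I =
    {P. primeideal P R \<and> (\<exists>f \<in> carrier R. P = {g \<in> carrier R. g \<otimes>\<^bsub>R\<^esub> f \<in> I})}"

definition unmixed :: "('r, 'm) ring_scheme \<Rightarrow> 'r set \<Rightarrow> bool" where
  "unmixed R I \<longleftrightarrow>
    (\<forall>P \<in> associated_primes R I. \<forall>Q \<in> associated_primes R I.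
      prime_height R P = prime_height R Q)"

definition regular_sequence :: "('r, 'm) ring_scheme \<Rightarrow> 'r list \<Rightarrow> bool" where
  "regular_sequence R xs \<longleftrightarrow>
    set xs \<subseteq> carrier R \<and>
    (\<forall>i < length xs. \<forall>a \<in> carrier R.
      xs ! i \<otimes>\<^bsub>R\<^esub> a \<in> genideal R (set (take i xs)) \<longrightarrow> a \<in> genideal R (set (take i xs))) \<and>
    genideal R (set xs) \<noteq> carrier R"

definition ideal_depth :: "('r, 'm) ring_scheme \<Rightarrow> 'r set \<Rightarrow> enat" where
  "ideal_depth R I = Sup {enat (length xs) | xs. set xs \<subseteq> I \<and> regular_sequence R xs}"

text \<open>
  For a maximal ideal \<open>M\<close> of a Noetherian ring \<open>R\<close>, the depth of \<open>M\<close> on \<open>R\<close> is the depth of the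
  localization \<open>R\<^sub>M\<close>, and the height of \<open>M\<close> is its dimension. The condition below is thus the usual
  one that every localization at a maximal ideal is a Cohen--Macaulay local ring, in the form
  used as the definition by Eisenbud (Commutative Algebra, Section 18.2).
\<close>

definition cohen_macaulay :: "('r, 'm) ring_scheme \<Rightarrow> bool" where
  "cohen_macaulay R \<longleftrightarrow>
    cring R \<and> noetherian_ring R \<and>
    (\<forall>M. maximalideal M R \<longrightarrow> ideal_depth R M = prime_height R M)"

end

theory Submission
  imports Defs "HOL-Library.Product_Lexorder"
begin

text \<open>
  The prime \<open>P\<^sub>0\<close> of all 2-minors and, for the graph with fewer components called \<open>H\<^sub>1\<close>, the prime
  \<open>P\<close> generated by the columns of \<open>H\<^sub>2\<close> and the 2-minors of the components of \<open>H\<^sub>1\<close> are both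
  associated to \<open>J\<close>: localizing at one of them, where the remaining variables and the minors
  across different components are units, turns \<open>J\<close> into that prime. Each is the kernel of a
  monomial map, which gives a long explicit chain of primes below \<open>P\<close> and one above \<open>P\<^sub>0\<close>. The sizes
  of the components make the total length of the two chains exceed the number of variables, and no
  chain of primes of a polynomial ring is longer than that number. Hence \<open>P\<close> and \<open>P\<^sub>0\<close> have
  different heights. Moreover a regular sequence of \<open>S/J\<close> at the origin yields a chain of primes of
  the same length starting at \<open>P\<close>, so that the depth there is smaller than the dimension.
\<close>

text \<open>The dimensions of two families of matrices decide the matter. Let m = |V|, let H1 have r
  components and n1 vertices, and let H2 have s components and n2 vertices. The matrices belonging
  to \<open>P\<close> have zero columns over H2 and one rank one block per component of H1, a family
  of dimension n1 + (m-1)r. The matrices of rank at most one have dimension m + n1 + n2 - 1. The two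
  agree exactly when n2 = (m-1)(r-1). If r <= s, then n2 >= ms > (m-1)(r-1) and the second family is
  strictly larger, which is why the graph with fewer components plays the role of H1. Each height is
  bounded on one side only: from below by the chain under \<open>P\<close>, and from above by
  prolonging every chain under the prime of all 2-minors with the chain above it. The comparison of
  depth and dimension at the origin uses the same two chains. Statements about a local ring are
  expressed by multipliers outside the prime.\<close>

section \<open>Regular sequences and associated primes\<close>

text \<open>A relation, so that chains of length n are pairs in its power \<open>^^ n\<close> and
  can be glued with \<open>relpow_add\<close>.\<close>

definition prime_step :: "('r, 'm) ring_scheme \<Rightarrow> ('r set \<times> 'r set) set" where
  "prime_step R = {(P, Q). primeideal P R \<and> primeideal Q R \<and> P \<subset> Q}"

definition colon :: "('r, 'm) ring_scheme \<Rightarrow> 'r set \<Rightarrow> 'r \<Rightarrow> 'r set" where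
  "colon R I f = {g \<in> carrier R. g \<otimes>\<^bsub>R\<^esub> f \<in> I}"

lemma (in ideal) lcomm_closed:
  assumes "cring R" "x \<otimes> f \<in> I" "x \<in> carrier R" "a \<in> carrier R" "f \<in> carrier R"
  shows "x \<otimes> (a \<otimes> f) \<in> I"
proof -
  interpret cring R by fact
  have "x \<otimes> (a \<otimes> f) = a \<otimes> (x \<otimes> f)" using assms by (simp add: m_lcomm)
  then show ?thesis using assms I_l_closed by simp
qed

lemma (in cring) colon_ideal:
  assumes I: "ideal I R" and f: "f \<in> carrier R"
  shows "ideal (colon R I f) R"
proof -
  interpret I: ideal I R by fact
  show ?thesis
  proof (rule idealI)
    show "subgroup (colon R I f) (add_monoid R)"
    proof (rule add.subgroupI)
      show "colon R I f \<noteq> {}"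
        using f by (auto simp: colon_def intro!: exI[of _ \<zero>])
    qed (use f in \<open>auto simp: colon_def l_distr l_minus\<close>)
  qed (use f in \<open>auto simp: colon_def ring_axioms m_assoc I.I_l_closed I.lcomm_closed is_cring\<close>)
qed

lemma (in noetherian_ring) maximal_among_ideals:
  assumes "\<C> \<noteq> {}" "\<And>I. I \<in> \<C> \<Longrightarrow> ideal I R"
  obtains I where "I \<in> \<C>" "\<And>K. K \<in> \<C> \<Longrightarrow> I \<subseteq> K \<Longrightarrow> K = I"
proof -
  have "\<exists>M\<in>\<C>. \<forall>X\<in>\<C>. M \<subseteq> X \<longrightarrow> X = M"
  proof (rule subset_Zorn_nonempty)
    fix C assume "C \<noteq> {}" "subset.chain \<C> C"
    then show "\<Union>C \<in> \<C>"
      using ideal_chain_is_trivial[of C] assms(2) unfolding pred_on.chain_def by blast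
  qed fact
  then show ?thesis using that by blast
qed

text \<open>The usual proof that a maximal annihilator is prime, carried out locally at
  \<open>M\<close>: the colons of multiples of \<open>f\<close> compete only as long as they stay
  inside \<open>M\<close>, that is, as long as the multiple is nonzero in the localization of R/I at
  \<open>M\<close>.\<close>

lemma (in cring) prime_colon_above:
  assumes noeth: "noetherian_ring R" and I: "ideal I R" and M: "primeideal M R"
    and f: "f \<in> carrier R" and sub: "colon R I f \<subseteq> M"
  obtains g where "g \<in> carrier R" "primeideal (colon R I g) R"
    "colon R I f \<subseteq> colon R I g" "colon R I g \<subseteq> M"
proof -
  interpret noetherian_ring R by fact
  interpret I: ideal I R by fact
  interpret M: primeideal M R by fact
  define \<C> where "\<C> = {colon R I (w \<otimes> f) | w. w \<in> carrier R \<and> colon R I (w \<otimes> f) \<subseteq> M}"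
  have "\<C> \<noteq> {}" unfolding \<C>_def using sub f by (auto intro!: exI[of _ \<one>])
  moreover have "ideal K R" if "K \<in> \<C>" for K
    using that colon_ideal[OF I] f unfolding \<C>_def by auto
  ultimately obtain Q where Q: "Q \<in> \<C>" and max: "\<And>K. K \<in> \<C> \<Longrightarrow> Q \<subseteq> K \<Longrightarrow> K = Q"
    using maximal_among_ideals[of \<C>] by metis
  then obtain w where w: "w \<in> carrier R" and Qw: "Q = colon R I (w \<otimes> f)" and QM: "Q \<subseteq> M"
    unfolding \<C>_def by auto
  have colon_mono: "colon R I g \<subseteq> colon R I (a \<otimes> g)" if "a \<in> carrier R" "g \<in> carrier R" for a g
    using that by (auto simp: colon_def I.lcomm_closed is_cring)
  have inQ: "a \<in> Q" if ab: "a \<in> carrier R" "b \<in> carrier R" "a \<otimes> b \<in> Q" "b \<notin> Q" for a b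
  proof -
    have bQ: "Q \<subseteq> colon R I (b \<otimes> (w \<otimes> f))"
      using colon_mono[of b "w \<otimes> f"] ab w f Qw by auto
    have a: "a \<in> colon R I (b \<otimes> (w \<otimes> f))"
      using ab w f unfolding Qw colon_def by (auto simp: m_assoc)
    show ?thesis
    proof (cases "colon R I (b \<otimes> (w \<otimes> f)) \<subseteq> M")
      case True
      then have "colon R I ((b \<otimes> w) \<otimes> f) \<in> \<C>"
        unfolding \<C>_def using ab w f
        by (simp add: m_assoc) (metis m_assoc m_closed)
      with max[of "colon R I ((b \<otimes> w) \<otimes> f)"] bQ a show ?thesis
        using ab w f by (simp add: m_assoc)
    next
      case False
      \<comment> \<open>Some \<open>s\<close> outside \<open>M\<close> makes \<open>b\<close>
        annihilate \<open>w \<otimes> f\<close> modulo \<open>I\<close>. Multiplying by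
        \<open>s\<close> is harmless since \<open>M\<close> is prime, so maximality applies to
        \<open>s \<otimes> (w \<otimes> f)\<close>; its colon contains \<open>b\<close>, against the
        choice of \<open>b\<close> outside \<open>Q\<close>.\<close>
      then obtain s where s: "s \<in> carrier R" "s \<notin> M" "s \<otimes> (b \<otimes> (w \<otimes> f)) \<in> I"
        unfolding colon_def by auto
      let ?K = "colon R I (s \<otimes> (w \<otimes> f))"
      have "t \<in> M" if t: "t \<in> ?K" for t
      proof -
        have "t \<otimes> s \<in> Q" using t s w f unfolding Qw colon_def by (auto simp: m_assoc)
        then show ?thesis using QM M.I_prime[of t s] s t unfolding colon_def by auto
      qed
      then have "colon R I ((s \<otimes> w) \<otimes> f) \<in> \<C>"
        unfolding \<C>_def using s w f by (auto intro!: exI[of _ "s \<otimes> w"] simp: m_assoc)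
      then have "?K = Q"
        using max[of ?K] colon_mono[of s "w \<otimes> f"] s w f unfolding Qw by (simp add: m_assoc)
      moreover have "b \<in> ?K"
        using ab s w f unfolding colon_def by (auto simp: m_lcomm)
      ultimately show ?thesis using ab by auto
    qed
  qed
  have "primeideal Q R"
  proof (rule primeidealI)
    show "ideal Q R" unfolding Qw using colon_ideal[OF I] w f by simp
    show "carrier R \<noteq> Q" using QM M.I_notcarr M.Icarr by blast
  qed (use inQ is_cring in blast)+
  then show ?thesis
    using that[of "w \<otimes> f"] w f QM Qw colon_mono[of w f] by auto
qed

text \<open>If the claim failed, every \<open>u\<close> killed by \<open>colon R I f\<close> modulo \<open>I\<close> would lie, locally at
  \<open>M\<close>, in \<open>I + xv\<close> for another such \<open>v\<close>. The ideals \<open>L u\<close> below are the contractions of the localized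
  ideals \<open>I + Ru\<close>, and a maximal one replaces Nakayama's lemma.\<close>

lemma (in cring) colon_below_after_regular:
  assumes noeth: "noetherian_ring R" and I: "ideal I R" and M: "primeideal M R"
    and f: "f \<in> carrier R" and sub: "colon R I f \<subseteq> M"
    and x: "x \<in> M" and reg: "\<And>a. a \<in> carrier R \<Longrightarrow> x \<otimes> a \<in> I \<Longrightarrow> a \<in> I"
    and I': "ideal I' R" and I'_decomp: "\<And>y. y \<in> I' \<Longrightarrow> \<exists>i\<in>I. \<exists>b\<in>carrier R. y = i \<oplus> x \<otimes> b"
  obtains u where "u \<in> carrier R" "colon R I f \<subseteq> colon R I u" "colon R I' u \<subseteq> M"
proof (rule ccontr)
  assume "\<not> thesis"
  interpret noetherian_ring R by fact
  interpret I: ideal I R by fact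
  interpret M: primeideal M R by fact
  have xc: "x \<in> carrier R" using x by (rule M.Icarr)
  define L where
    "L u = {y \<in> carrier R. \<exists>s\<in>carrier R - M. \<exists>r\<in>carrier R. s \<otimes> y \<ominus> r \<otimes> u \<in> I}" for u
  have LI: "y \<in> L u"
    if "y \<in> carrier R" "s \<in> carrier R - M" "r \<in> carrier R" "s \<otimes> y \<ominus> r \<otimes> u \<in> I" for y s r u
    using that unfolding L_def by blast
  define U where "U = {u \<in> carrier R. colon R I f \<subseteq> colon R I u}"
  have sM: "s \<otimes> t \<in> carrier R - M" if "s \<in> carrier R - M" "t \<in> carrier R - M" for s t
    using that M.I_prime by auto
  have L_ideal: "ideal (L u) R" if u: "u \<in> carrier R" for u
  proof (rule idealI[OF ring_axioms])
    show "subgroup (L u) (add_monoid R)"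
    proof (rule add.subgroupI)
      show "L u \<subseteq> carrier R" unfolding L_def by auto
      have "\<one> \<in> carrier R - M" using M.one_imp_carrier M.I_notcarr by auto
      then have "\<zero> \<in> L u" unfolding L_def using u
        by (auto intro!: bexI[of _ \<one>] bexI[of _ \<zero>] simp: minus_eq)
      then show "L u \<noteq> {}" by auto
    next
      fix a assume "a \<in> L u"
      then obtain s r where *: "a \<in> carrier R" "s \<in> carrier R - M" "r \<in> carrier R"
        "s \<otimes> a \<ominus> r \<otimes> u \<in> I" unfolding L_def by auto
      have "s \<otimes> (\<ominus> a) \<ominus> (\<ominus> r) \<otimes> u = \<ominus> (s \<otimes> a \<ominus> r \<otimes> u)"
        using * u by (simp, algebra)
      then have "s \<otimes> (\<ominus> a) \<ominus> (\<ominus> r) \<otimes> u \<in> I" using * by simp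
      then show "\<ominus> a \<in> L u"
        using LI[of "\<ominus> a" s "\<ominus> r" u] * by auto
    next
      fix a b assume "a \<in> L u" "b \<in> L u"
      then obtain s r s' r' where *: "a \<in> carrier R" "s \<in> carrier R - M" "r \<in> carrier R"
        "s \<otimes> a \<ominus> r \<otimes> u \<in> I" "b \<in> carrier R" "s' \<in> carrier R - M" "r' \<in> carrier R"
        "s' \<otimes> b \<ominus> r' \<otimes> u \<in> I" unfolding L_def by auto
      have "(s \<otimes> s') \<otimes> (a \<oplus> b) \<ominus> (s' \<otimes> r \<oplus> s \<otimes> r') \<otimes> u
          = s' \<otimes> (s \<otimes> a \<ominus> r \<otimes> u) \<oplus> s \<otimes> (s' \<otimes> b \<ominus> r' \<otimes> u)"
        using * u by (simp, algebra)
      then have "(s \<otimes> s') \<otimes> (a \<oplus> b) \<ominus> (s' \<otimes> r \<oplus> s \<otimes> r') \<otimes> u \<in> I"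
        using * by (simp add: I.I_l_closed)
      then show "a \<oplus> b \<in> L u"
        using LI[of "a \<oplus> b" "s \<otimes> s'" "s' \<otimes> r \<oplus> s \<otimes> r'" u] * sM[of s s'] by auto
    qed
  next
    fix a c assume "a \<in> L u" and c: "c \<in> carrier R"
    then obtain s r where *: "a \<in> carrier R" "s \<in> carrier R - M" "r \<in> carrier R"
      "s \<otimes> a \<ominus> r \<otimes> u \<in> I" unfolding L_def by auto
    have "s \<otimes> (c \<otimes> a) \<ominus> (c \<otimes> r) \<otimes> u = c \<otimes> (s \<otimes> a \<ominus> r \<otimes> u)"
      using * u c by (simp, algebra)
    then have "s \<otimes> (c \<otimes> a) \<ominus> (c \<otimes> r) \<otimes> u \<in> I" using * c by (simp add: I.I_l_closed)
    then show ca: "c \<otimes> a \<in> L u"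
      using LI[of "c \<otimes> a" s "c \<otimes> r" u] * c by auto
    then show "a \<otimes> c \<in> L u" using * c by (simp add: m_comm)
  qed
  have self: "u \<in> L u" if u: "u \<in> carrier R" for u
  proof -
    have "\<one> \<in> carrier R - M" using M.one_imp_carrier M.I_notcarr by auto
    moreover have "\<one> \<otimes> u \<ominus> \<one> \<otimes> u \<in> I" using u by (simp add: minus_eq r_neg)
    ultimately show ?thesis unfolding L_def using u by blast
  qed
  \<comment> \<open>The condition \<open>f \<in> L u\<close> records that \<open>f\<close> is
    locally a multiple of \<open>u\<close> modulo \<open>I\<close>. Once \<open>u\<close> is locally
    zero, so is \<open>f\<close>, and this will be the contradiction.\<close>
  have "{L u | u. u \<in> U \<and> f \<in> L u} \<noteq> {}"
    using self[OF f] f unfolding U_def by auto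
  then obtain u where u: "u \<in> U" "f \<in> L u"
    and max: "\<And>v. v \<in> U \<Longrightarrow> f \<in> L v \<Longrightarrow> L u \<subseteq> L v \<Longrightarrow> L v = L u"
    using maximal_among_ideals[of "{L u | u. u \<in> U \<and> f \<in> L u}"] L_ideal unfolding U_def
    by (smt (verit, del_insts) mem_Collect_eq)
  have uc: "u \<in> carrier R" using u unfolding U_def by auto
  from \<open>\<not> thesis\<close> u(1) that have "\<not> colon R I' u \<subseteq> M" unfolding U_def by blast
  \<comment> \<open>Failure of the claim at \<open>u\<close> makes \<open>u\<close> locally a
    multiple of \<open>x \<otimes> v\<close> modulo \<open>I\<close>. As \<open>x\<close> is regular
    modulo \<open>I\<close>, everything in \<open>colon R I f\<close> kills \<open>v\<close> as
    well, so \<open>v\<close> is again a candidate, with \<open>L v\<close> at least as large as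
    \<open>L u\<close>.\<close>
  then obtain s where s: "s \<in> carrier R - M" "s \<otimes> u \<in> I'" unfolding colon_def by auto
  then obtain i v where iv: "i \<in> I" "v \<in> carrier R" "s \<otimes> u = i \<oplus> x \<otimes> v"
    using I'_decomp by blast
  have ic: "i \<in> carrier R" using iv by auto
  have "v \<in> U"
  proof -
    have "q \<in> colon R I v" if q: "q \<in> colon R I f" for q
    proof -
      have qu: "q \<in> carrier R" "q \<otimes> u \<in> I" using q u unfolding U_def colon_def by auto
      have "x \<otimes> (q \<otimes> v) = s \<otimes> (q \<otimes> u) \<ominus> q \<otimes> i"
      proof -
        have "s \<otimes> (q \<otimes> u) = q \<otimes> (s \<otimes> u)" using qu s uc by (simp add: m_lcomm)
        also have "\<dots> = q \<otimes> i \<oplus> x \<otimes> (q \<otimes> v)" using qu iv ic xc by (simp add: r_distr m_lcomm)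
        finally show ?thesis using qu iv ic xc by (simp, algebra)
      qed
      also have "\<dots> \<in> I" using qu s iv by (simp add: I.I_l_closed minus_eq)
      finally show ?thesis using reg qu iv unfolding colon_def by auto
    qed
    then show ?thesis unfolding U_def using iv by auto
  qed
  have Luv: "L u \<subseteq> L v"
  proof
    fix y assume "y \<in> L u"
    then obtain t r where *: "y \<in> carrier R" "t \<in> carrier R - M" "r \<in> carrier R"
      "t \<otimes> y \<ominus> r \<otimes> u \<in> I" unfolding L_def by auto
    have "(s \<otimes> t) \<otimes> y \<ominus> (r \<otimes> x) \<otimes> v = s \<otimes> (t \<otimes> y \<ominus> r \<otimes> u) \<oplus> r \<otimes> (s \<otimes> u \<ominus> x \<otimes> v)"
      using * s uc iv(2) xc by (simp, algebra)
    also have "s \<otimes> u \<ominus> x \<otimes> v = i" using iv xc ic by (simp, algebra)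
    finally have "(s \<otimes> t) \<otimes> y \<ominus> (r \<otimes> x) \<otimes> v \<in> I"
      using * s iv by (simp add: I.I_l_closed)
    then show "y \<in> L v" using LI[of y "s \<otimes> t" "r \<otimes> x" v] * sM[of s t] s xc by auto
  qed
  then have "L v = L u" using max[OF \<open>v \<in> U\<close>] u by blast
  then have "v \<in> L u" using self iv by blast
  then obtain t r where t: "t \<in> carrier R - M" "r \<in> carrier R" "t \<otimes> v \<ominus> r \<otimes> u \<in> I"
    unfolding L_def by auto
  \<comment> \<open>From s u = x v and t v = r u modulo \<open>I\<close> follows (t s - x r) u = 0
    modulo \<open>I\<close>. Since \<open>x\<close> lies in \<open>M\<close> and t s does not,
    \<open>w\<close> is a local unit; it corresponds to the factor 1 - x r in Nakayama's
    lemma.\<close>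
  define w where "w = t \<otimes> s \<ominus> x \<otimes> r"
  have wc: "w \<in> carrier R" unfolding w_def using t s xc by auto
  have wM: "w \<notin> M"
  proof
    assume "w \<in> M"
    moreover have "t \<otimes> s = w \<oplus> x \<otimes> r" unfolding w_def using t s xc by (simp, algebra)
    ultimately have "t \<otimes> s \<in> M" using x t by (simp add: M.I_r_closed)
    then show False using M.I_prime t s by blast
  qed
  have "w \<otimes> u = t \<otimes> i \<oplus> x \<otimes> (t \<otimes> v \<ominus> r \<otimes> u)"
  proof -
    have "w \<otimes> u = t \<otimes> (s \<otimes> u) \<ominus> x \<otimes> (r \<otimes> u)" unfolding w_def using t s xc uc by (simp, algebra)
    also have "\<dots> = t \<otimes> i \<oplus> x \<otimes> (t \<otimes> v \<ominus> r \<otimes> u)"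
      unfolding iv(3) using t s xc uc ic iv by (simp, algebra)
    finally show ?thesis .
  qed
  then have wu: "w \<otimes> u \<in> I" using t iv xc by (simp add: I.I_l_closed)
  obtain s' r' where s': "s' \<in> carrier R - M" "r' \<in> carrier R" "s' \<otimes> f \<ominus> r' \<otimes> u \<in> I"
    using u(2) unfolding L_def by auto
  have "(w \<otimes> s') \<otimes> f = w \<otimes> (s' \<otimes> f \<ominus> r' \<otimes> u) \<oplus> r' \<otimes> (w \<otimes> u)"
    using s' wc f uc by (simp, algebra)
  then have "(w \<otimes> s') \<otimes> f \<in> I" using s' wc wu by (simp add: I.I_l_closed)
  then have "w \<otimes> s' \<in> M" using sub s' wc unfolding colon_def by auto
  then show False using M.I_prime wc wM s' by blast
qed

lemma (in cring) genideal_insert_decomp: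
  assumes "A \<subseteq> carrier R" "x \<in> carrier R" "y \<in> genideal R (insert x A)"
  shows "\<exists>i\<in>genideal R A. \<exists>b\<in>carrier R. y = i \<oplus> x \<otimes> b"
proof -
  interpret A: ideal "genideal R A" R using assms by (rule_tac genideal_ideal)
  let ?I = "genideal R A <+>\<^bsub>R\<^esub> PIdl x"
  have id: "ideal ?I R"
    using add_ideals A.ideal_axioms cgenideal_ideal assms by blast
  have "insert x A \<subseteq> ?I"
  proof -
    have "\<zero> \<oplus> x \<in> ?I" unfolding set_add_defs set_mult_def
      using A.zero_closed cgenideal_self[OF assms(2)] by auto
    moreover have "a \<oplus> \<zero> \<in> ?I" if "a \<in> A" for a
    proof -
      have "a \<in> genideal R A" using genideal_self assms that by blast
      moreover have "\<zero> \<in> PIdl x" 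
        using cgenideal_ideal[OF assms(2)] additive_subgroup.zero_closed ideal.axioms(1) by blast
      moreover have "a = a \<oplus> \<zero>" using assms that by auto
      ultimately show ?thesis unfolding set_add_defs set_mult_def using assms that by force
    qed
    ultimately show ?thesis using assms by (auto simp: subset_iff)
  qed
  then have "genideal R (insert x A) \<subseteq> ?I" using genideal_minimal[OF id] by blast
  with assms(3) obtain i p where "i \<in> genideal R A" "p \<in> PIdl x" "y = i \<oplus> p"
    unfolding set_add_defs set_mult_def by auto
  moreover from this(2) obtain b where "b \<in> carrier R" "p = b \<otimes> x" unfolding cgenideal_def by auto
  ultimately show ?thesis using assms m_comm by auto
qed

text \<open>This is depth <= dim R/P for an associated prime P, with explicit primes: the i-th one
  is a colon of the ideal of the first i entries. The next entry lies in the next prime because the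
  enlarged ideal contains it, and not in the current one because it is regular modulo the current
  ideal.\<close>

theorem (in cring) regular_sequence_prime_chain:
  assumes noeth: "noetherian_ring R" and M: "primeideal M R"
    and reg: "regular_sequence R xs" and xs: "set xs \<subseteq> M"
    and f: "f \<in> carrier R" and prime: "primeideal (colon R {\<zero>} f) R"
    and sub: "colon R {\<zero>} f \<subseteq> M"
  obtains Q where "(colon R {\<zero>} f, Q) \<in> prime_step R ^^ length xs" "Q \<subseteq> M"
proof -
  interpret M: primeideal M R by fact
  have "\<exists>g\<in>carrier R. primeideal (colon R (genideal R (set (take i xs))) g) R \<and>
      colon R (genideal R (set (take i xs))) g \<subseteq> M \<and>
      (colon R {\<zero>} f, colon R (genideal R (set (take i xs))) g) \<in> prime_step R ^^ i"
    if "i \<le> length xs" for i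
    using that
  proof (induction i)
    case 0
    have "genideal R {} = {\<zero>}"
      using genideal_minimal[OF zeroideal, of "{}"] genideal_ideal[of "{}"]
        additive_subgroup.zero_closed ideal.axioms(1) by blast
    then show ?case using f prime sub by auto
  next
    case (Suc i)
    then obtain g where g: "g \<in> carrier R"
      "primeideal (colon R (genideal R (set (take i xs))) g) R"
      "colon R (genideal R (set (take i xs))) g \<subseteq> M"
      "(colon R {\<zero>} f, colon R (genideal R (set (take i xs))) g) \<in> prime_step R ^^ i" by auto
    define x where "x = xs ! i"
    define A where "A = set (take i xs)"
    have take: "set (take (Suc i) xs) = insert x A"
      using Suc.prems unfolding x_def A_def by (simp add: take_Suc_conv_app_nth)
    have xM: "x \<in> M" using xs Suc.prems unfolding x_def by auto
    then have xc: "x \<in> carrier R" by (rule M.Icarr)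
    have Ac: "A \<subseteq> carrier R" using xs M.Icarr unfolding A_def by (meson in_set_takeD subset_iff)
    have I: "ideal (genideal R A) R" using Ac by (rule genideal_ideal)
    have I': "ideal (genideal R (insert x A)) R" using Ac xc by (intro genideal_ideal) auto
    have regx: "a \<in> genideal R A" if "a \<in> carrier R" "x \<otimes> a \<in> genideal R A" for a
      using reg Suc.prems that unfolding regular_sequence_def A_def x_def by auto
    obtain u where u: "u \<in> carrier R" "colon R (genideal R A) g \<subseteq> colon R (genideal R A) u"
      "colon R (genideal R (insert x A)) u \<subseteq> M"
      using colon_below_after_regular[OF noeth I M g(1) _ xM regx I']
        genideal_insert_decomp[OF Ac xc] g(3) unfolding A_def by blast
    obtain h where h: "h \<in> carrier R" "primeideal (colon R (genideal R (insert x A)) h) R"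
      "colon R (genideal R (insert x A)) u \<subseteq> colon R (genideal R (insert x A)) h"
      "colon R (genideal R (insert x A)) h \<subseteq> M"
      using prime_colon_above[OF noeth I' M u(1,3)] by blast
    have "genideal R A \<subseteq> genideal R (insert x A)"
      using genideal_minimal[OF I'] genideal_self[of "insert x A"] Ac xc by blast
    then have "colon R (genideal R A) u \<subseteq> colon R (genideal R (insert x A)) u"
      unfolding colon_def by auto
    with u h have sub: "colon R (genideal R A) g \<subseteq> colon R (genideal R (insert x A)) h" by blast
    have "x \<in> genideal R (insert x A)" using genideal_self[of "insert x A"] Ac xc by blast
    then have xin: "x \<in> colon R (genideal R (insert x A)) h"
      using xc h I' unfolding colon_def by (auto intro: ideal.I_r_closed)
    have "x \<notin> colon R (genideal R A) g"
    proof
      assume "x \<in> colon R (genideal R A) g"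
      then have "g \<in> genideal R A" using regx g unfolding colon_def by auto
      then have "\<one> \<in> colon R (genideal R A) g" using g unfolding colon_def by auto
      then show False
        using g(2) unfolding A_def[symmetric] primeideal_def primeideal_axioms_def
        using ideal.one_imp_carrier by blast
    qed
    with xin sub have "colon R (genideal R A) g \<subset> colon R (genideal R (insert x A)) h" by blast
    then have "(colon R (genideal R A) g, colon R (genideal R (insert x A)) h) \<in> prime_step R"
      unfolding prime_step_def using g(2) h(2) unfolding A_def by blast
    then show ?case using g(4) h unfolding take A_def by (auto intro!: bexI[of _ h])
  qed
  from this[of "length xs"] show ?thesis using that by auto
qed


lemma poly_mapping_sum_singles:
  fixes p :: "'x \<Rightarrow>\<^sub>0 'c::comm_monoid_add"
  shows "p = (\<Sum>m\<in>Poly_Mapping.keys p. Poly_Mapping.single m (Poly_Mapping.lookup p m))"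
proof (rule poly_mapping_eqI)
  fix k
  have "Poly_Mapping.lookup (\<Sum>m\<in>Poly_Mapping.keys p. Poly_Mapping.single m (Poly_Mapping.lookup p m)) k
      = (\<Sum>m\<in>Poly_Mapping.keys p. if m = k then Poly_Mapping.lookup p k else 0)"
    unfolding lookup_sum by (intro sum.cong) (auto simp: lookup_single when_def)
  then show "Poly_Mapping.lookup p k = Poly_Mapping.lookup
      (\<Sum>m\<in>Poly_Mapping.keys p. Poly_Mapping.single m (Poly_Mapping.lookup p m)) k"
    by (auto simp: in_keys_iff)
qed

section \<open>The polynomial ring\<close>

lemma matrix_poly_ring_simps [simp]:
  "x \<otimes>\<^bsub>matrix_poly_ring V W\<^esub> y = x * y" "x \<oplus>\<^bsub>matrix_poly_ring V W\<^esub> y = x + y"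
  "\<one>\<^bsub>matrix_poly_ring V W\<^esub> = 1" "\<zero>\<^bsub>matrix_poly_ring V W\<^esub> = 0"
  by (simp_all add: matrix_poly_ring_def)

lemma matrix_poly_ring_carrier:
  "carrier (matrix_poly_ring V W) =
    {p. \<forall>m \<in> Poly_Mapping.keys p. Poly_Mapping.keys m \<subseteq> V \<times> W}"
  by (simp add: matrix_poly_ring_def)

abbreviation const :: "'k::field \<Rightarrow> ('v \<Rightarrow>\<^sub>0 nat) \<Rightarrow>\<^sub>0 'k" where
  "const \<equiv> Poly_Mapping.single 0"

lemma matrix_poly_ring_single_closed [simp]:
  "Poly_Mapping.keys m \<subseteq> V \<times> W \<Longrightarrow> Poly_Mapping.single m c \<in> carrier (matrix_poly_ring V W)"
  by (simp add: matrix_poly_ring_carrier)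

lemma matrix_poly_ring_closed:
  assumes "p \<in> carrier (matrix_poly_ring V W)" "q \<in> carrier (matrix_poly_ring V W)"
  shows "p + q \<in> carrier (matrix_poly_ring V W)" "p * q \<in> carrier (matrix_poly_ring V W)"
    "- p \<in> carrier (matrix_poly_ring V W)" "p - q \<in> carrier (matrix_poly_ring V W)"
proof -
  have minus: "Poly_Mapping.keys (- r) = Poly_Mapping.keys r" for r :: "('a, 'b, 'c) matrix_poly"
    by (auto simp: in_keys_iff)
  have add: "p + q \<in> carrier (matrix_poly_ring V W)"
    if "p \<in> carrier (matrix_poly_ring V W)" "q \<in> carrier (matrix_poly_ring V W)" for p q
    using that keys_add[of p q] unfolding matrix_poly_ring_carrier by blast
  have uminus: "- p \<in> carrier (matrix_poly_ring V W)"
    if "p \<in> carrier (matrix_poly_ring V W)" for p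
    using that unfolding matrix_poly_ring_carrier by (simp add: minus)
  show "p + q \<in> carrier (matrix_poly_ring V W)" by (rule add) fact+
  show "p - q \<in> carrier (matrix_poly_ring V W)"
    using add[OF assms(1) uminus[OF assms(2)]] by simp
  show "- p \<in> carrier (matrix_poly_ring V W)" by (rule uminus) fact
  show "p * q \<in> carrier (matrix_poly_ring V W)"
    unfolding matrix_poly_ring_carrier
  proof safe
    fix m i t assume m: "m \<in> Poly_Mapping.keys (p * q)" and it: "(i, t) \<in> Poly_Mapping.keys m"
    from m keys_mult[of p q] obtain a b where ab: "m = a + b" "a \<in> Poly_Mapping.keys p"
      "b \<in> Poly_Mapping.keys q" by blast
    then have "(i, t) \<in> Poly_Mapping.keys a \<union> Poly_Mapping.keys b"
      using it keys_add[of a b] by blast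
    then show "i \<in> V" "t \<in> W" using assms ab unfolding matrix_poly_ring_carrier by blast+
  qed
qed

lemma matrix_poly_ring_cring: "cring (matrix_poly_ring V W :: ('a, 'b, 'k::field) matrix_poly ring)"
  (is "cring ?S")
proof (rule cringI)
  show "abelian_group ?S"
  proof (rule abelian_groupI)
    fix x assume "x \<in> carrier ?S"
    then show "\<exists>y\<in>carrier ?S. y \<oplus>\<^bsub>?S\<^esub> x = \<zero>\<^bsub>?S\<^esub>"
      by (intro bexI[of _ "- x"]) (auto intro: matrix_poly_ring_closed)
  qed (auto simp: matrix_poly_ring_closed add.assoc add.commute, simp add: matrix_poly_ring_carrier)
  show "comm_monoid ?S"
    by (rule comm_monoidI)
      (auto simp: matrix_poly_ring_closed mult.assoc mult.commute, simp add: matrix_poly_ring_carrier)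
qed (auto simp: distrib_right)

lemma matrix_poly_ring_a_inv [simp]:
  assumes "p \<in> carrier (matrix_poly_ring V W)"
  shows "\<ominus>\<^bsub>matrix_poly_ring V W\<^esub> p = - p"
proof -
  interpret cring "matrix_poly_ring V W" by (rule matrix_poly_ring_cring)
  show ?thesis
    by (rule sum_zero_eq_neg[symmetric]) (use assms in \<open>auto simp: matrix_poly_ring_closed\<close>)
qed

lemma matrix_poly_ideal_closed:
  assumes "ideal I (matrix_poly_ring V W)"
  shows "p \<in> I \<Longrightarrow> q \<in> I \<Longrightarrow> p + q \<in> I" "p \<in> I \<Longrightarrow> q \<in> I \<Longrightarrow> p - q \<in> I"
    "p \<in> I \<Longrightarrow> - p \<in> I" "0 \<in> I"
    "p \<in> I \<Longrightarrow> r \<in> carrier (matrix_poly_ring V W) \<Longrightarrow> r * p \<in> I"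
    "p \<in> I \<Longrightarrow> r \<in> carrier (matrix_poly_ring V W) \<Longrightarrow> p * r \<in> I"
    "p \<in> I \<Longrightarrow> p \<in> carrier (matrix_poly_ring V W)"
proof -
  interpret ideal I "matrix_poly_ring V W" by fact
  have add: "p \<in> I \<Longrightarrow> q \<in> I \<Longrightarrow> p + q \<in> I" for p q
    using additive_subgroup.a_closed[OF additive_subgroup_axioms, of p q] by simp
  have uminus: "p \<in> I \<Longrightarrow> - p \<in> I" for p
    using additive_subgroup.a_inv_closed[OF additive_subgroup_axioms, of p] a_Hcarr by fastforce
  show "p \<in> I \<Longrightarrow> q \<in> I \<Longrightarrow> p + q \<in> I" "p \<in> I \<Longrightarrow> - p \<in> I" by (fact add uminus)+
  show "p \<in> I \<Longrightarrow> q \<in> I \<Longrightarrow> p - q \<in> I" using add[of p "- q"] uminus by simp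
  show "0 \<in> I" using additive_subgroup.zero_closed[OF additive_subgroup_axioms] by simp
  show "p \<in> I \<Longrightarrow> r \<in> carrier (matrix_poly_ring V W) \<Longrightarrow> r * p \<in> I" using I_l_closed[of p r] by simp
  show "p \<in> I \<Longrightarrow> r \<in> carrier (matrix_poly_ring V W) \<Longrightarrow> p * r \<in> I" using I_r_closed[of p r] by simp
  show "p \<in> I \<Longrightarrow> p \<in> carrier (matrix_poly_ring V W)" using a_Hcarr by simp
qed

lemma matrix_poly_ideal_sum:
  assumes "ideal I (matrix_poly_ring V W)" "\<And>a. a \<in> A \<Longrightarrow> f a \<in> I"
  shows "sum f A \<in> I"
  using assms(2) by (induction A rule: infinite_finite_induct)
    (auto intro: matrix_poly_ideal_closed[OF assms(1)])

lemma matrix_poly_prime_dvd: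
  assumes P: "primeideal P (matrix_poly_ring V W)"
    and "x ^ n * y \<in> P" "x \<notin> P" "x \<in> carrier (matrix_poly_ring V W)" "y \<in> carrier (matrix_poly_ring V W)"
  shows "y \<in> P"
  using assms(2)
proof (induction n)
  case (Suc n)
  interpret primeideal P "matrix_poly_ring V W" by fact
  have cl: "x ^ n \<in> carrier (matrix_poly_ring V W)" 
    by (induction n) (auto simp: assms matrix_poly_ring_closed, simp add: matrix_poly_ring_carrier)
  have "x * (x ^ n * y) \<in> P" using Suc.prems by (simp add: mult.assoc)
  then show ?case using I_prime[of x "x ^ n * y"] Suc.IH assms cl by (simp add: matrix_poly_ring_closed)
qed simp

lemma matrix_poly_prime_no_const:
  assumes P: "primeideal P (matrix_poly_ring V W)" and "const c \<in> P"
  shows "c = 0"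
proof (rule ccontr)
  interpret primeideal P "matrix_poly_ring V W" by fact
  assume "c \<noteq> 0"
  then have "const (inverse c) * const c = (1 :: ('a, 'b, 'c) matrix_poly)" 
    by (simp add: mult_single)
  moreover have "const (inverse c) * const c \<in> P"
    using matrix_poly_ideal_closed(5)[OF is_ideal, of "const c" "const (inverse c)"] assms by simp
  ultimately have "\<one>\<^bsub>matrix_poly_ring V W\<^esub> \<in> P" by simp
  then show False using one_imp_carrier I_notcarr by simp
qed


section \<open>Chains of primes in the polynomial ring\<close>

definition power_product :: "'c::comm_monoid_mult list \<Rightarrow> nat list \<Rightarrow> 'c" where
  "power_product xs \<alpha> = prod_list (map2 (^) xs \<alpha>)"

lemma power_product_simps [simp]:
  "power_product [] \<alpha> = 1"
  "power_product (x # xs) (a # \<alpha>) = x ^ a * power_product xs \<alpha>"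
  by (simp_all add: power_product_def)

text \<open>Coquand and Lombardi: a polynomial relation between the \<open>x\<^sub>i\<close> is, up to a power of \<open>x\<^sub>0\<close>, a
  relation between the remaining ones modulo \<open>x\<^sub>0\<close>, namely the part of least degree in \<open>x\<^sub>0\<close>.\<close>

lemma prime_chain_no_relation:
  fixes xs :: "('a, 'b, 'k::field) matrix_poly list"
  assumes "\<And>i. i \<le> length xs \<Longrightarrow> primeideal (P i) (matrix_poly_ring V W)"
    and "\<And>i. i < length xs \<Longrightarrow> P i \<subseteq> P (Suc i)"
    and "\<And>i. i < length xs \<Longrightarrow> xs ! i \<in> P (Suc i) - P i"
    and "finite A" "\<And>\<alpha>. \<alpha> \<in> A \<Longrightarrow> length \<alpha> = length xs"
    and "(\<Sum>\<alpha>\<in>A. const (c \<alpha>) * power_product xs \<alpha>) \<in> P 0" "\<alpha> \<in> A"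
  shows "c \<alpha> = 0"
  using assms
proof (induction xs arbitrary: P A c \<alpha>)
  case Nil
  then have "A = {[]}" by auto
  then show ?case using matrix_poly_prime_no_const[OF Nil.prems(1)[of 0], of "c []"] Nil.prems by simp
next
  case (Cons x xs)
  let ?S = "matrix_poly_ring V W :: ('a, 'b, 'k) matrix_poly ring"
  have P: "primeideal (P 0) ?S" "primeideal (P 1) ?S" using Cons.prems(1)[of 0] Cons.prems(1)[of 1] by simp_all
  have P01: "P 0 \<subseteq> P 1" using Cons.prems(2)[of 0] by simp
  have x: "x \<in> P 1" "x \<notin> P 0" using Cons.prems(3)[of 0] by auto
  note I1 = primeideal.axioms(1)[OF P(2)]
  have xc: "x \<in> carrier ?S" using x matrix_poly_ideal_closed(7)[OF I1] by auto
  have xsc: "y \<in> carrier ?S" if y: "y \<in> set xs" for y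
  proof -
    obtain i where "i < length xs" "y = xs ! i" using y by (metis in_set_conv_nth)
    then have "y \<in> P (Suc (Suc i))" "ideal (P (Suc (Suc i))) ?S"
      using Cons.prems(3)[of "Suc i"] primeideal.axioms(1)[OF Cons.prems(1)[of "Suc (Suc i)"]] by simp_all
    then show ?thesis by (metis matrix_poly_ideal_closed(7))
  qed
  have pow: "y ^ n \<in> carrier ?S" if "y \<in> carrier ?S" for y n
    using that by (induction n) (auto simp: matrix_poly_ring_closed, simp add: matrix_poly_ring_carrier)
  have one: "1 \<in> carrier ?S" by (simp add: matrix_poly_ring_carrier)
  have "set ys \<subseteq> carrier ?S \<longrightarrow> power_product ys \<beta> \<in> carrier ?S" if "length \<beta> = length ys" for ys \<beta>
    using that
    by (induction \<beta> ys rule: list_induct2)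
      (simp_all add: one matrix_poly_ring_closed(2) pow)
  then have ppc: "power_product xs \<beta> \<in> carrier ?S" if "length \<beta> = length xs" for \<beta>
    using xsc that by (simp add: subset_iff)
  have constc: "const d \<in> carrier ?S" for d by simp
  show ?case
  proof (rule ccontr)
    assume nz: "c \<alpha> \<noteq> 0"
    \<comment> \<open>Only terms with nonzero coefficient compete for the least exponent
      \<open>e\<close> of \<open>x\<close>, so that a term attaining it has a coefficient which the
      induction hypothesis contradicts.\<close>
    define A' where "A' = {\<alpha>\<in>A. c \<alpha> \<noteq> 0}"
    have A': "finite A'" "\<alpha> \<in> A'" using Cons.prems nz unfolding A'_def by auto
    have A'_form: "\<exists>a \<beta>'. \<beta> = a # \<beta>' \<and> length \<beta>' = length xs" if "\<beta> \<in> A'" for \<beta>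
      using Cons.prems(5)[of \<beta>] that unfolding A'_def by (cases \<beta>) auto
    define e where "e = Min (hd ` A')"
    have e_min: "e \<le> hd \<beta>" if "\<beta> \<in> A'" for \<beta> unfolding e_def using A' that by auto
    have "e \<in> hd ` A'" unfolding e_def using A' by (intro Min_in) auto
    then obtain \<gamma> where \<gamma>: "\<gamma> \<in> A'" "hd \<gamma> = e" by auto
    define t where "t \<beta> = const (c \<beta>) * (x ^ (hd \<beta> - e) * power_product xs (tl \<beta>))" for \<beta>
    have tc: "t \<beta> \<in> carrier ?S" if "\<beta> \<in> A'" for \<beta>
      unfolding t_def using A'_form[OF that] by (auto intro!: matrix_poly_ring_closed pow ppc xc)
    define B where "B = {\<beta>\<in>A'. hd \<beta> = e}"
    have "(\<Sum>\<alpha>\<in>A. const (c \<alpha>) * power_product (x # xs) \<alpha>)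
        = (\<Sum>\<alpha>\<in>A'. const (c \<alpha>) * power_product (x # xs) \<alpha>)"
      unfolding A'_def using Cons.prems(4) by (intro sum.mono_neutral_right) auto
    also have "\<dots> = (\<Sum>\<alpha>\<in>A'. x ^ e * t \<alpha>)"
    proof (rule sum.cong)
      fix \<beta> assume b: "\<beta> \<in> A'"
      then obtain a \<beta>' where ab: "\<beta> = a # \<beta>'" using A'_form by blast
      then have "x ^ a = x ^ e * x ^ (a - e)" using e_min[OF b] by (simp flip: power_add)
      then show "const (c \<beta>) * power_product (x # xs) \<beta> = x ^ e * t \<beta>"
        unfolding t_def ab by (simp add: ac_simps)
    qed simp
    also have "\<dots> = x ^ e * sum t A'" by (simp add: sum_distrib_left)
    finally have "x ^ e * sum t A' \<in> P 0" using Cons.prems(6) by simp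
    moreover have "sum t A' \<in> carrier ?S"
      using A'(1) tc by (induction A' rule: finite_induct)
        (auto simp: matrix_poly_ring_closed, simp add: matrix_poly_ring_carrier)
    ultimately have "sum t A' \<in> P 0" using matrix_poly_prime_dvd[OF P(1)] x xc by blast
    then have 1: "sum t A' \<in> P 1" using P01 by blast
    have 2: "sum t (A' - B) \<in> P 1"
    proof (rule matrix_poly_ideal_sum[OF I1])
      fix \<beta> assume b: "\<beta> \<in> A' - B"
      then obtain a \<beta>' where ab: "\<beta> = a # \<beta>'" "length \<beta>' = length xs" using A'_form by blast
      have "a > e" using e_min[of \<beta>] b ab unfolding B_def by auto
      then have "x ^ (a - e) = x * x ^ (a - e - 1)" by (metis power_minus_mult mult.commute zero_less_diff)
      then have "t \<beta> = x * (const (c \<beta>) * (x ^ (a - e - 1) * power_product xs \<beta>'))"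
        unfolding t_def ab by (simp add: ac_simps)
      moreover have "const (c \<beta>) * (x ^ (a - e - 1) * power_product xs \<beta>') \<in> carrier ?S"
        using ab by (intro matrix_poly_ring_closed pow ppc xc constc)
      ultimately show "t \<beta> \<in> P 1"
        using matrix_poly_ideal_closed(6)[OF I1 x(1)] by simp
    qed
    have "sum t A' - sum t (A' - B) = sum t B"
      using A'(1) sum.subset_diff[of B A' t] unfolding B_def by auto
    with matrix_poly_ideal_closed(2)[OF I1 1 2] have "sum t B \<in> P 1" by simp
    also have "sum t B = (\<Sum>\<beta>\<in>B. const (c (e # tl \<beta>)) * power_product xs (tl \<beta>))"
      using A'_form unfolding t_def B_def by (intro sum.cong) fastforce+
    also have "\<dots> = (\<Sum>\<beta>\<in>tl ` B. const (c (e # \<beta>)) * power_product xs \<beta>)"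
    proof -
      have "inj_on tl B"
        by (rule inj_onI, rule list.expand) (use A'_form in \<open>auto simp: B_def\<close>)
      then show ?thesis by (simp add: sum.reindex)
    qed
    finally have sum: "(\<Sum>\<beta>\<in>tl ` B. const (c (e # \<beta>)) * power_product xs \<beta>) \<in> P (Suc 0)" by simp
    have "c (e # tl \<gamma>) = 0"
    proof (rule Cons.IH[where P = "\<lambda>i. P (Suc i)" and A = "tl ` B" and c = "\<lambda>\<beta>. c (e # \<beta>)"])
      fix i assume i: "i < length xs"
      show "P (Suc i) \<subseteq> P (Suc (Suc i))" using Cons.prems(2)[of "Suc i"] i by simp
      show "xs ! i \<in> P (Suc (Suc i)) - P (Suc i)" using Cons.prems(3)[of "Suc i"] i by simp
    next
      fix i assume "i \<le> length xs"
      then show "primeideal (P (Suc i)) ?S" using Cons.prems(1)[of "Suc i"] by simp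
    next
      show "finite (tl ` B)" using A'(1) unfolding B_def by simp
      show "tl \<gamma> \<in> tl ` B" using \<gamma> unfolding B_def by simp
      fix \<beta> assume "\<beta> \<in> tl ` B"
      then show "length \<beta> = length xs" using A'_form unfolding B_def by fastforce
    qed (fact sum)
    moreover have "e # tl \<gamma> = \<gamma>" using A'_form[OF \<gamma>(1)] \<gamma> by auto
    ultimately show False using \<gamma>(1) unfolding A'_def by simp
  qed
qed


section \<open>Algebraic dependence of more polynomials than variables, by counting
  monomials\<close>

definition bounded_monomials :: "'v set \<Rightarrow> nat \<Rightarrow> ('v \<Rightarrow>\<^sub>0 nat) set" where
  "bounded_monomials E d = {m. Poly_Mapping.keys m \<subseteq> E \<and> (\<forall>e. Poly_Mapping.lookup m e \<le> d)}"

lemma bounded_monomials_card: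
  assumes "finite E"
  shows "finite (bounded_monomials E d)" "card (bounded_monomials E d) \<le> (d + 1) ^ card E"
proof -
  let ?r = "\<lambda>m. restrict (Poly_Mapping.lookup m) E"
  have inj: "inj_on ?r (bounded_monomials E d)"
  proof (rule inj_onI, rule poly_mapping_eqI)
    fix m m' k assume *: "m \<in> bounded_monomials E d" "m' \<in> bounded_monomials E d" "?r m = ?r m'"
    show "Poly_Mapping.lookup m k = Poly_Mapping.lookup m' k"
    proof (cases "k \<in> E")
      case True then show ?thesis using fun_cong[OF *(3), of k] by simp
    next
      case False
      then have "k \<notin> Poly_Mapping.keys m" "k \<notin> Poly_Mapping.keys m'"
        using * unfolding bounded_monomials_def by auto
      then show ?thesis by (simp add: in_keys_iff)
    qed
  qed
  have sub: "?r ` bounded_monomials E d \<subseteq> E \<rightarrow>\<^sub>E {..d}"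
    unfolding bounded_monomials_def by auto
  have fin: "finite (E \<rightarrow>\<^sub>E {..d})" using assms by (intro finite_PiE) auto
  show "finite (bounded_monomials E d)" using finite_imageD[OF finite_subset[OF sub fin] inj] .
  have "card (bounded_monomials E d) \<le> card (E \<rightarrow>\<^sub>E {..d})"
    using card_mono[OF fin sub] card_image[OF inj] by simp
  then show "card (bounded_monomials E d) \<le> (d + 1) ^ card E" using assms by (simp add: card_PiE)
qed

lemma bounded_polys_mult:
  assumes "Poly_Mapping.keys p \<subseteq> bounded_monomials E a" "Poly_Mapping.keys q \<subseteq> bounded_monomials E b"
  shows "Poly_Mapping.keys (p * q) \<subseteq> bounded_monomials E (a + b)"
proof
  fix m assume "m \<in> Poly_Mapping.keys (p * q)"
  then obtain u v where uv: "m = u + v" "u \<in> Poly_Mapping.keys p" "v \<in> Poly_Mapping.keys q"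
    using keys_mult[of p q] by blast
  then have "u \<in> bounded_monomials E a" "v \<in> bounded_monomials E b" using assms by auto
  then show "m \<in> bounded_monomials E (a + b)"
    unfolding uv(1) bounded_monomials_def using keys_add[of u v] by (auto simp: lookup_add add_mono)
qed

lemma bounded_monomials_mono: "a \<le> b \<Longrightarrow> bounded_monomials E a \<subseteq> bounded_monomials E b"
  unfolding bounded_monomials_def by (auto intro: order_trans)

lemma bounded_polys_power:
  fixes p :: "('v \<Rightarrow>\<^sub>0 nat) \<Rightarrow>\<^sub>0 'k::field"
  assumes "Poly_Mapping.keys p \<subseteq> bounded_monomials E a"
  shows "Poly_Mapping.keys (p ^ n) \<subseteq> bounded_monomials E (n * a)"
proof (induction n)
  case (Suc n)
  then show ?case using bounded_polys_mult[OF assms Suc] by simp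
qed (simp add: bounded_monomials_def)

lemma bounded_polys_power_product:
  fixes xs :: "(('v \<Rightarrow>\<^sub>0 nat) \<Rightarrow>\<^sub>0 'k::field) list"
  assumes "length xs = length \<alpha>" "\<forall>x\<in>set xs. Poly_Mapping.keys x \<subseteq> bounded_monomials E a"
    "\<forall>n\<in>set \<alpha>. n \<le> D"
  shows "Poly_Mapping.keys (power_product xs \<alpha>) \<subseteq> bounded_monomials E (length xs * (D * a))"
  using assms
proof (induction xs \<alpha> rule: list_induct2)
  case (Cons x xs n \<alpha>)
  have "Poly_Mapping.keys (x ^ n) \<subseteq> bounded_monomials E (D * a)"
    using bounded_polys_power[of x E a n] bounded_monomials_mono[of "n * a" "D * a" E] Cons.prems by auto
  then show ?case using bounded_polys_mult[of "x ^ n" E "D * a" "power_product xs \<alpha>"] Cons by simp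
qed (simp add: bounded_monomials_def)

text \<open>For n polynomials in |E| < n variables with exponents at most a, the (D+1)^n power
  products with exponents up to D lie in a space spanned by at most (n D a + 1)^|E| monomials. The
  first number is of larger order in D.\<close>

lemma algebraic_relation_exists:
  fixes xs :: "(('v \<Rightarrow>\<^sub>0 nat) \<Rightarrow>\<^sub>0 'k::field) list"
  assumes E: "finite E" and xs: "\<And>x m. x \<in> set xs \<Longrightarrow> m \<in> Poly_Mapping.keys x \<Longrightarrow> Poly_Mapping.keys m \<subseteq> E"
    and len: "length xs > card E"
  obtains A c where "finite A" "\<And>\<alpha>. \<alpha> \<in> A \<Longrightarrow> length \<alpha> = length xs"
    "(\<Sum>\<alpha>\<in>A. const (c \<alpha>) * power_product xs \<alpha>) = 0" "\<exists>\<alpha>\<in>A. c \<alpha> \<noteq> 0"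
proof -
  interpret vs: vector_space "\<lambda>c p. const c * p :: ('v \<Rightarrow>\<^sub>0 nat) \<Rightarrow>\<^sub>0 'k"
    by unfold_locales (auto simp: distrib_left distrib_right single_add mult_single simp flip: mult.assoc)
  obtain a where a: "\<forall>x\<in>set xs. Poly_Mapping.keys x \<subseteq> bounded_monomials E a"
  proof -
    define U where "U = (\<Union>x\<in>set xs. \<Union>m\<in>Poly_Mapping.keys x. Poly_Mapping.lookup m ` Poly_Mapping.keys m)"
    have "finite U" unfolding U_def by auto
    then obtain a where a: "\<forall>u\<in>U. u \<le> a" using finite_nat_set_iff_bounded_le by blast
    have "Poly_Mapping.lookup m e \<le> a" if "x \<in> set xs" "m \<in> Poly_Mapping.keys x" for x m e
    proof (cases "e \<in> Poly_Mapping.keys m")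
      case True then show ?thesis using a that unfolding U_def by blast
    qed (simp add: in_keys_iff)
    then show ?thesis using xs that[of a] unfolding bounded_monomials_def by blast
  qed
  define n where "n = length xs"
  \<comment> \<open>This value makes the comparison explicit: n D a + 1 <= (n a + 1)(D + 1), and the
    |E|-th power of the right side is D (D+1)^|E| < (D+1)^n.\<close>
  define D where "D = (n * a + 1) ^ card E"
  define A where "A = {\<alpha>. set \<alpha> \<subseteq> {..D} \<and> length \<alpha> = n}"
  have A: "finite A" "card A = (D + 1) ^ n"
    unfolding A_def by (auto simp: card_lists_length_eq finite_lists_length_eq)
  define T where "T = (\<lambda>m. Poly_Mapping.single m (1 :: 'k)) ` bounded_monomials E (n * (D * a))"
  have T: "finite T" "card T \<le> (n * (D * a) + 1) ^ card E"
    unfolding T_def using bounded_monomials_card[OF E, of "n * (D * a)"]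
    by (auto intro: order_trans[OF card_image_le])
  have span: "p \<in> vs.span T" if "Poly_Mapping.keys p \<subseteq> bounded_monomials E (n * (D * a))" for p
  proof -
    have "Poly_Mapping.single m (Poly_Mapping.lookup p m) \<in> vs.span T"
      if "m \<in> Poly_Mapping.keys p" for m
    proof -
      have "const (Poly_Mapping.lookup p m) * Poly_Mapping.single m 1 \<in> vs.span T"
        using \<open>Poly_Mapping.keys p \<subseteq> _\<close> that by (intro vs.span_scale vs.span_base) (auto simp: T_def)
      then show ?thesis by (simp add: mult_single)
    qed
    then show ?thesis by (subst poly_mapping_sum_singles) (rule vs.span_sum)
  qed
  have "(n * (D * a) + 1) ^ card E < card A"
  proof -
    have "n * (D * a) + 1 \<le> (n * a + 1) * (D + 1)" by (simp add: algebra_simps)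
    then have "(n * (D * a) + 1) ^ card E \<le> ((n * a + 1) * (D + 1)) ^ card E" by (rule power_mono) simp
    also have "\<dots> = D * (D + 1) ^ card E" by (simp only: power_mult_distrib flip: D_def)
    also have "\<dots> < (D + 1) * (D + 1) ^ card E" by simp
    also have "\<dots> = (D + 1) ^ Suc (card E)" by simp
    also have "\<dots> \<le> (D + 1) ^ n" using len unfolding n_def by (intro power_increasing) auto
    finally show ?thesis using A by simp
  qed
  then have card: "card T < card A" using T by simp
  have len: "length \<alpha> = length xs" if "\<alpha> \<in> A" for \<alpha> using that unfolding A_def n_def by simp
  have in_span: "power_product xs \<alpha> \<in> vs.span T" if "\<alpha> \<in> A" for \<alpha>
    using bounded_polys_power_product[of xs \<alpha> E a D] a that 
    unfolding A_def by (intro span) (auto simp: n_def)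
  show ?thesis
  \<comment> \<open>Linear dependence concerns the set of products, so coinciding products are
    treated apart: they give a relation with two terms at once.\<close>
  proof (cases "inj_on (power_product xs) A")
    case False
    then obtain \<alpha> \<beta> where ab: "\<alpha> \<in> A" "\<beta> \<in> A" "\<alpha> \<noteq> \<beta>" "power_product xs \<alpha> = power_product xs \<beta>"
      unfolding inj_on_def by auto
    show ?thesis
      by (rule that[of "{\<alpha>, \<beta>}" "\<lambda>\<gamma>. if \<gamma> = \<alpha> then 1 else - 1"])
        (use ab len in \<open>auto simp: single_uminus\<close>)
  next
    case True
    let ?Y = "power_product xs ` A"
    have "vs.dependent ?Y"
    proof (rule ccontr)
      assume "vs.independent ?Y"
      then have "card ?Y \<le> card T" using vs.independent_span_bound[OF T(1)] in_span by blast
      then show False using card card_image[OF True] by simp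
    qed
    then obtain u where u: "\<exists>v\<in>?Y. u v \<noteq> 0" "(\<Sum>v\<in>?Y. const (u v) * v) = 0"
      using vs.dependent_finite[of ?Y] A by auto
    have "(\<Sum>\<alpha>\<in>A. const (u (power_product xs \<alpha>)) * power_product xs \<alpha>) = 0"
      using u(2) by (simp add: sum.reindex[OF True])
    then show ?thesis
      using u(1) by (intro that[of A "\<lambda>\<alpha>. u (power_product xs \<alpha>)"] A(1) len) auto
  qed
qed

text \<open>Choosing in each prime an element outside the preceding one gives polynomials without a
  nontrivial relation, even modulo the first prime, whereas more than |V||W| polynomials always have
  one.\<close>

theorem prime_chain_length_le:
  assumes "finite V" "finite W"
    and chain: "(P, Q) \<in> prime_step (matrix_poly_ring V W :: ('a, 'b, 'k::field) matrix_poly ring) ^^ n"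
  shows "n \<le> card V * card W"
proof (rule ccontr)
  let ?S = "matrix_poly_ring V W :: ('a, 'b, 'k::field) matrix_poly ring"
  assume n: "\<not> n \<le> card V * card W"
  obtain F where F: "\<And>i. i < n \<Longrightarrow> (F i, F (Suc i)) \<in> prime_step ?S"
    using chain unfolding relpow_fun_conv by blast
  have prime: "primeideal (F i) ?S" if "i \<le> n" for i
    using F[of i] F[of "i - 1"] that n unfolding prime_step_def by (cases i) auto
  have "\<exists>x. i < n \<longrightarrow> x \<in> F (Suc i) - F i" for i using F[of i] unfolding prime_step_def by auto
  then obtain x where x: "\<And>i. i < n \<Longrightarrow> x i \<in> F (Suc i) - F i" by metis
  define xs where "xs = map x [0..<n]"
  have "y \<in> carrier ?S" if "y \<in> set xs" for y
    using that x matrix_poly_ideal_closed(7)[OF primeideal.axioms(1)[OF prime]] unfolding xs_def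
    by (auto simp: Suc_le_eq) (metis DiffD1 Suc_leI)
  then have "Poly_Mapping.keys m \<subseteq> V \<times> W" if "y \<in> set xs" "m \<in> Poly_Mapping.keys y" for y m
    using that unfolding matrix_poly_ring_carrier by blast
  then obtain A c where Ac: "finite A" "\<And>\<alpha>. \<alpha> \<in> A \<Longrightarrow> length \<alpha> = length xs"
    "(\<Sum>\<alpha>\<in>A. const (c \<alpha>) * power_product xs \<alpha>) = 0" "\<exists>\<alpha>\<in>A. c \<alpha> \<noteq> 0"
    using algebraic_relation_exists[of "V \<times> W" xs thesis] assms(1,2) n
    by (auto simp: xs_def card_cartesian_product)
  have "c \<alpha> = 0" if "\<alpha> \<in> A" for \<alpha>
    using prime F x Ac(1-3) that matrix_poly_ideal_closed(4)[OF primeideal.axioms(1)[OF prime[of 0]]]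
    by (intro prime_chain_no_relation[where P = F and xs = xs and A = A]) (auto simp: xs_def prime_step_def)
  then show False using Ac(4) by blast
qed


section \<open>Substitution homomorphisms\<close>

definition monomial_subst :: "('v \<Rightarrow> 'c::comm_semiring_1) \<Rightarrow> ('v \<Rightarrow>\<^sub>0 nat) \<Rightarrow> 'c" where
  "monomial_subst s m = (\<Prod>x\<in>Poly_Mapping.keys m. s x ^ Poly_Mapping.lookup m x)"

definition poly_subst ::
    "('v \<Rightarrow> ('w \<Rightarrow>\<^sub>0 nat) \<Rightarrow>\<^sub>0 'k::field) \<Rightarrow> (('v \<Rightarrow>\<^sub>0 nat) \<Rightarrow>\<^sub>0 'k) \<Rightarrow> (('w \<Rightarrow>\<^sub>0 nat) \<Rightarrow>\<^sub>0 'k)" where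
  "poly_subst s p =
    (\<Sum>m\<in>Poly_Mapping.keys p. const (Poly_Mapping.lookup p m) * monomial_subst s m)"

lemma monomial_subst_superset:
  assumes "finite A" "Poly_Mapping.keys m \<subseteq> A"
  shows "monomial_subst s m = (\<Prod>x\<in>A. s x ^ Poly_Mapping.lookup m x)"
  unfolding monomial_subst_def using assms
  by (intro prod.mono_neutral_left) (auto simp: in_keys_iff)

lemma monomial_subst_add: "monomial_subst s (m + m') = monomial_subst s m * monomial_subst s m'"
proof -
  let ?A = "Poly_Mapping.keys m \<union> Poly_Mapping.keys m'"
  have "monomial_subst s (m + m') = (\<Prod>x\<in>?A. s x ^ Poly_Mapping.lookup (m + m') x)"
    using keys_add[of m m'] by (intro monomial_subst_superset) auto
  also have "\<dots> = (\<Prod>x\<in>?A. s x ^ Poly_Mapping.lookup m x) * (\<Prod>x\<in>?A. s x ^ Poly_Mapping.lookup m' x)"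
    by (simp add: lookup_add power_add prod.distrib)
  also have "\<dots> = monomial_subst s m * monomial_subst s m'"
    by (simp add: monomial_subst_superset[of ?A])
  finally show ?thesis .
qed

lemma monomial_subst_zero [simp]: "monomial_subst s 0 = 1"
  by (simp add: monomial_subst_def)

lemma poly_subst_add: "poly_subst s (p + q) = poly_subst s p + poly_subst s q"
  unfolding poly_subst_def
  by (rule setsum_keys_plus_distrib) (auto simp: single_add distrib_right)

lemma poly_subst_zero [simp]: "poly_subst s 0 = 0"
  by (simp add: poly_subst_def)

lemma poly_subst_single [simp]: "poly_subst s (Poly_Mapping.single m c) = const c * monomial_subst s m"
  by (simp add: poly_subst_def)

lemma poly_subst_one [simp]: "poly_subst s 1 = 1"
  using poly_subst_single[of s 0 1] by simp

lemma poly_subst_uminus: "poly_subst s (- p) = - poly_subst s p"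
  using poly_subst_add[of s p "- p"] by (simp add: eq_neg_iff_add_eq_0 add.commute)

lemma poly_subst_diff: "poly_subst s (p - q) = poly_subst s p - poly_subst s q"
  using poly_subst_add[of s p "- q"] by (simp add: poly_subst_uminus)

lemma poly_subst_sum: "poly_subst s (sum f A) = (\<Sum>a\<in>A. poly_subst s (f a))"
  by (induction A rule: infinite_finite_induct) (auto simp: poly_subst_add)

lemma poly_subst_mult: "poly_subst s (p * q) = poly_subst s p * poly_subst s q"
proof -
  let ?p = "\<lambda>m. Poly_Mapping.single m (Poly_Mapping.lookup p m)"
  let ?q = "\<lambda>m. Poly_Mapping.single m (Poly_Mapping.lookup q m)"
  have "p * q = (\<Sum>m\<in>Poly_Mapping.keys p. ?p m) * (\<Sum>m\<in>Poly_Mapping.keys q. ?q m)"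
    by (simp flip: poly_mapping_sum_singles)
  also have "\<dots> = (\<Sum>m\<in>Poly_Mapping.keys p. \<Sum>m'\<in>Poly_Mapping.keys q. ?p m * ?q m')"
    by (simp add: sum_product)
  also have "poly_subst s \<dots> =
      (\<Sum>m\<in>Poly_Mapping.keys p. \<Sum>m'\<in>Poly_Mapping.keys q. poly_subst s (?p m) * poly_subst s (?q m'))"
    unfolding poly_subst_sum
    by (intro sum.cong refl) (simp add: mult_single monomial_subst_add flip: mult.assoc,
        simp add: mult_single[of 0 _ 0, symmetric, simplified] ac_simps)
  also have "\<dots> = (\<Sum>m\<in>Poly_Mapping.keys p. poly_subst s (?p m)) * (\<Sum>m\<in>Poly_Mapping.keys q. poly_subst s (?q m))"
    by (simp add: sum_product)
  also have "\<dots> = poly_subst s p * poly_subst s q"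
    by (simp only: poly_subst_single) (simp only: poly_subst_def)
  finally show ?thesis .
qed

lemma poly_subst_power: "poly_subst s (p ^ n) = poly_subst s p ^ n"
  by (induction n) (auto simp: poly_subst_mult)

lemma poly_subst_prod: "poly_subst s (prod f A) = (\<Prod>a\<in>A. poly_subst s (f a))"
  by (induction A rule: infinite_finite_induct) (auto simp: poly_subst_mult)

lemma poly_subst_comp: "poly_subst t (poly_subst s p) = poly_subst (\<lambda>x. poly_subst t (s x)) p"
  unfolding poly_subst_def[of s p] poly_subst_sum poly_subst_mult
  by (simp add: poly_subst_def[of _ p] monomial_subst_def poly_subst_prod poly_subst_power)

definition variable :: "'w \<Rightarrow> ('w \<Rightarrow>\<^sub>0 nat) \<Rightarrow>\<^sub>0 'k::field" where
  "variable w = Poly_Mapping.single (Poly_Mapping.single w 1) 1"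

lemma matrix_var_variable: "matrix_var i t = variable (i, t)"
  by (simp add: matrix_var_def variable_def)

lemma variable_closed [simp]: "x \<in> V \<times> W \<Longrightarrow> variable x \<in> carrier (matrix_poly_ring V W)"
  by (simp add: variable_def matrix_poly_ring_carrier)

lemma poly_subst_variable [simp]: "poly_subst s (variable x) = s x"
  by (simp add: variable_def monomial_subst_def)

lemma poly_subst_cong:
  assumes "p \<in> carrier (matrix_poly_ring V W)" "\<And>x. x \<in> V \<times> W \<Longrightarrow> s x = s' x"
  shows "poly_subst s p = poly_subst s' p"
proof -
  have "s x = s' x" if "m \<in> Poly_Mapping.keys p" "x \<in> Poly_Mapping.keys m" for m x
    using assms that unfolding matrix_poly_ring_carrier by blast
  then show ?thesis
    unfolding poly_subst_def monomial_subst_def by (auto intro!: sum.cong prod.cong)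
qed

definition subst_kernel ::
    "'a set \<Rightarrow> 'b set \<Rightarrow> ('a \<times> 'b \<Rightarrow> ('w \<Rightarrow>\<^sub>0 nat) \<Rightarrow>\<^sub>0 'k::field) \<Rightarrow> ('a, 'b, 'k) matrix_poly set" where
  "subst_kernel V W s = {p \<in> carrier (matrix_poly_ring V W). poly_subst s p = 0}"

text \<open>A kernel of a homomorphism into an integral domain. The linear order on
  \<open>'w\<close> provides the domain, since leading monomials multiply without cancellation; the
  parameters used later are ordered lexicographically.\<close>

lemma subst_kernel_prime:
  fixes s :: "'a \<times> 'b \<Rightarrow> ('w::linorder \<Rightarrow>\<^sub>0 nat) \<Rightarrow>\<^sub>0 'k::field"
  shows "primeideal (subst_kernel V W s) (matrix_poly_ring V W)"
proof -
  let ?S = "matrix_poly_ring V W :: ('a, 'b, 'k) matrix_poly ring"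
  interpret cring ?S by (rule matrix_poly_ring_cring)
  have one: "1 \<in> carrier ?S" "0 \<in> carrier ?S" using one_closed zero_closed by simp_all
  show ?thesis
  proof (rule primeidealI)
    show "ideal (subst_kernel V W s) ?S"
    proof (rule idealI[OF ring_axioms])
      show "subgroup (subst_kernel V W s) (add_monoid ?S)"
        by (rule add.subgroupI)
          (use one in \<open>auto simp: subst_kernel_def poly_subst_add poly_subst_uminus matrix_poly_ring_closed\<close>)
    qed (auto simp: subst_kernel_def poly_subst_mult matrix_poly_ring_closed)
    show "carrier ?S \<noteq> subst_kernel V W s"
      using one by (auto simp: subst_kernel_def set_eq_iff intro!: exI[of _ 1])
  qed (auto simp: subst_kernel_def poly_subst_mult is_cring)
qed

text \<open>Specializing further by \<open>t\<close> enlarges the kernel, and \<open>p\<close>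
  certifies that the inclusion is strict. All explicit chains of primes below are made of such
  specializations.\<close>

lemma subst_kernel_step:
  fixes s s' :: "'a \<times> 'b \<Rightarrow> ('w::linorder \<Rightarrow>\<^sub>0 nat) \<Rightarrow>\<^sub>0 'k::field"
  assumes "\<And>x. x \<in> V \<times> W \<Longrightarrow> s' x = poly_subst t (s x)"
    and "p \<in> carrier (matrix_poly_ring V W)" "poly_subst s' p = 0" "poly_subst s p \<noteq> 0"
  shows "(subst_kernel V W s, subst_kernel V W s') \<in> prime_step (matrix_poly_ring V W)"
proof -
  have "poly_subst s' q = 0" if "q \<in> subst_kernel V W s" for q
  proof -
    have "poly_subst s' q = poly_subst t (poly_subst s q)"
      using that assms(1) unfolding poly_subst_comp subst_kernel_def by (intro poly_subst_cong) auto
    then show ?thesis using that unfolding subst_kernel_def by simp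
  qed
  then have "subst_kernel V W s \<subseteq> subst_kernel V W s'" unfolding subst_kernel_def by auto
  moreover have "p \<in> subst_kernel V W s'" "p \<notin> subst_kernel V W s"
    using assms unfolding subst_kernel_def by auto
  ultimately show ?thesis unfolding prime_step_def using subst_kernel_prime by blast
qed

lemma set_indexed_chain:
  assumes "finite F" "\<And>D x. D \<subseteq> F \<Longrightarrow> x \<in> F - D \<Longrightarrow> (P D, P (insert x D)) \<in> prime_step R"
  shows "(P {}, P F) \<in> prime_step R ^^ card F"
  using assms
proof (induction F rule: finite_induct)
  case (insert x F)
  then have "(P {}, P F) \<in> prime_step R ^^ card F" "(P F, P (insert x F)) \<in> prime_step R" by blast+
  then show ?case using insert.hyps by auto
qed simp


section \<open>The toric primes\<close>

text \<open>\<open>(0, i, v)\<close> is a free variable replacing \<open>x\<^sub>i\<^sub>v\<close>, while \<open>(1, i, v)\<close> and \<open>(2, _, v)\<close> are the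
  coordinates of the rank one matrices: one coefficient for the row \<open>i\<close> in each block of
  columns, blocks being named by a representative column, and one coefficient for each column.\<close>

type_synonym ('a, 'b) param = "nat \<times> 'a \<times> 'b"

definition row_param :: "('b \<Rightarrow> 'b) \<Rightarrow> 'a \<times> 'b \<Rightarrow> ('a, 'b) param" where
  "row_param rep x = (1, fst x, rep (snd x))"

definition col_param :: "'a \<times> 'b \<Rightarrow> ('a, 'b) param" where
  "col_param x = (2, undefined, snd x)"

text \<open>Empty \<open>Z\<close> and constant \<open>rep\<close> give the prime of all 2-minors.
  The second prime arises when \<open>Z\<close> is the vertex set of one factor of the join and
  \<open>rep\<close> chooses a vertex in each component of the other.\<close>

definition toric_subst ::
    "'b set \<Rightarrow> ('b \<Rightarrow> 'b) \<Rightarrow> 'a \<times> 'b \<Rightarrow> (('a, 'b) param \<Rightarrow>\<^sub>0 nat) \<Rightarrow>\<^sub>0 'k::field" where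
  "toric_subst Z rep x =
    (if snd x \<in> Z then 0 else variable (row_param rep x) * variable (col_param x))"

lemma param_distinct [simp]:
  "row_param rep x \<noteq> col_param y" "col_param y \<noteq> row_param rep x"
  "(0, z) \<noteq> row_param rep x" "(0, z) \<noteq> col_param y"
  "row_param rep x \<noteq> (0, z)" "col_param y \<noteq> (0, z)"
  "row_param rep x = row_param rep' x' \<longleftrightarrow> fst x = fst x' \<and> rep (snd x) = rep' (snd x')"
  "col_param y = col_param y' \<longleftrightarrow> snd y = snd y'"
  by (auto simp: row_param_def col_param_def)

lemma variable_nonzero [simp]: "variable w \<noteq> (0 :: ('w \<Rightarrow>\<^sub>0 nat) \<Rightarrow>\<^sub>0 'k::field)"
  by (metis lookup_single_eq lookup_zero one_neq_zero variable_def)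

lemma variable_mult: "variable v * variable w = Poly_Mapping.single (Poly_Mapping.single v 1 + Poly_Mapping.single w 1) 1"
  by (simp add: variable_def mult_single)

lemma single_diff_nonzero:
  assumes "m \<noteq> m'"
  shows "Poly_Mapping.single m 1 - Poly_Mapping.single m' 1 \<noteq> (0 :: _ \<Rightarrow>\<^sub>0 'k::field)"
  using assms by (metis eq_iff_diff_eq_0 lookup_single_eq lookup_single_not_eq one_neq_zero)

text \<open>The positions in \<open>F\<close> start as independent variables and are specialized one
  by one to their toric value. In a column of \<open>Z\<close> the variable itself becomes zero.
  Elsewhere \<open>block\<close> supplies a 2-minor whose only corner in \<open>F\<close> is (i, v);
  it vanishes exactly when (i, v) is specialized.\<close>

lemma toric_prime_below_chain:
  fixes V :: "'a::linorder set" and W :: "'b::linorder set"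
  assumes fin: "finite V" "finite W" and F: "F \<subseteq> V \<times> W"
    and block: "\<And>i v. (i, v) \<in> F \<Longrightarrow> v \<notin> Z \<Longrightarrow> \<exists>i0\<in>V. \<exists>v0\<in>W. v0 \<notin> Z \<and> rep v0 = rep v \<and>
      (i, v0) \<notin> F \<and> (i0, v) \<notin> F \<and> (i0, v0) \<notin> F"
  shows "\<exists>Q. (Q, subst_kernel V W (toric_subst Z rep :: _ \<Rightarrow> _ \<Rightarrow>\<^sub>0 'k::field))
    \<in> prime_step (matrix_poly_ring V W) ^^ card F"
proof -
  let ?\<tau> = "toric_subst Z rep :: 'a \<times> 'b \<Rightarrow> (('a, 'b) param \<Rightarrow>\<^sub>0 nat) \<Rightarrow>\<^sub>0 'k"
  define \<sigma> :: "('a \<times> 'b) set \<Rightarrow> 'a \<times> 'b \<Rightarrow> (('a, 'b) param \<Rightarrow>\<^sub>0 nat) \<Rightarrow>\<^sub>0 'k"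
    where "\<sigma> D x = (if x \<in> F - D then variable (0, x) else ?\<tau> x)" for D x
  have "(subst_kernel V W (\<sigma> D), subst_kernel V W (\<sigma> (insert x D))) \<in> prime_step (matrix_poly_ring V W)"
    if D: "D \<subseteq> F" "x \<in> F - D" for D x
  proof -
    define t :: "('a, 'b) param \<Rightarrow> (('a, 'b) param \<Rightarrow>\<^sub>0 nat) \<Rightarrow>\<^sub>0 'k"
      where "t w = (if w = (0, x) then ?\<tau> x else variable w)" for w
    have t: "\<sigma> (insert x D) y = poly_subst t (\<sigma> D y)" for y
      using D by (auto simp: \<sigma>_def t_def toric_subst_def poly_subst_mult)
    obtain i v where x: "x = (i, v)" by force
    show ?thesis
    proof (cases "v \<in> Z")
      case True
      show ?thesis
        by (rule subst_kernel_step[where t = t and p = "variable x"])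
          (use t D F True in \<open>auto simp: \<sigma>_def x toric_subst_def\<close>)
    next
      case False
      then obtain i0 v0 where b: "i0 \<in> V" "v0 \<in> W" "v0 \<notin> Z" "rep v0 = rep v" "(i, v0) \<notin> F"
        "(i0, v) \<notin> F" "(i0, v0) \<notin> F" using block D x by blast
      let ?p = "variable (i, v) * variable (i0, v0) - variable (i, v0) * variable (i0, v) :: ('a, 'b, 'k) matrix_poly"
      have iv: "i \<in> V" "v \<in> W" using F D x by auto
      show ?thesis
      proof (rule subst_kernel_step[where t = t and p = ?p])
        show "?p \<in> carrier (matrix_poly_ring V W)"
          using iv b by (auto intro!: matrix_poly_ring_closed)
        show "poly_subst (\<sigma> (insert x D)) ?p = 0"
          using b False x by (simp add: poly_subst_diff poly_subst_mult \<sigma>_def toric_subst_def row_param_def col_param_def)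
        define m :: "('a, 'b) param \<Rightarrow>\<^sub>0 nat" where "m = Poly_Mapping.single (0, x) 1 +
          (Poly_Mapping.single (row_param rep (i0, v0)) 1 + Poly_Mapping.single (col_param (i0, v0)) 1)"
        define m' :: "('a, 'b) param \<Rightarrow>\<^sub>0 nat" where "m' =
          (Poly_Mapping.single (row_param rep (i, v0)) 1 + Poly_Mapping.single (col_param (i, v0)) 1) +
          (Poly_Mapping.single (row_param rep (i0, v)) 1 + Poly_Mapping.single (col_param (i0, v)) 1)"
        \<comment> \<open>Before the specialization only one of the two monomials of the minor
          contains the free variable, so they cannot cancel.\<close>
        have "Poly_Mapping.lookup m (0, x) \<noteq> Poly_Mapping.lookup m' (0, x)"
          unfolding m_def m'_def by (simp add: lookup_add lookup_single)
        then have "m \<noteq> m'" by auto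
        moreover have "poly_subst (\<sigma> D) ?p = Poly_Mapping.single m 1 - Poly_Mapping.single m' 1"
          using b False D x unfolding m_def m'_def
          by (simp add: poly_subst_diff poly_subst_mult \<sigma>_def toric_subst_def)
            (simp add: variable_def mult_single)
        ultimately show "poly_subst (\<sigma> D) ?p \<noteq> 0"
          using single_diff_nonzero[of m m'] by simp
      qed (use t in auto)
    qed
  qed
  then have "(subst_kernel V W (\<sigma> {}), subst_kernel V W (\<sigma> F)) \<in> prime_step (matrix_poly_ring V W) ^^ card F"
    using set_indexed_chain[of F "\<lambda>D. subst_kernel V W (\<sigma> D)"] F fin
      finite_subset[OF F] by blast
  moreover have "\<sigma> F = ?\<tau>" by (auto simp: \<sigma>_def)
  ultimately show ?thesis by auto
qed

text \<open>Rank one matrices have |V| + |W| parameters, one of them redundant by scaling, which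
  explains the length. The parameters are set to zero singly, and a step is strict because some
  nonzero entry vanishes with it.\<close>

lemma toric_prime_above_chain:
  fixes V :: "'a::linorder set" and W :: "'b::linorder set"
  assumes fin: "finite V" "finite W" and ne: "i0 \<in> V" "v0 \<in> W"
  shows "(subst_kernel V W (toric_subst {} (\<lambda>_. v0) :: _ \<Rightarrow> _ \<Rightarrow>\<^sub>0 'k::field),
      subst_kernel V W (\<lambda>_. 0 :: (('a, 'b) param \<Rightarrow>\<^sub>0 nat) \<Rightarrow>\<^sub>0 'k))
    \<in> prime_step (matrix_poly_ring V W) ^^ (card V + card W - 1)"
proof -
  let ?\<tau> = "toric_subst {} (\<lambda>_. v0) :: 'a \<times> 'b \<Rightarrow> (('a, 'b) param \<Rightarrow>\<^sub>0 nat) \<Rightarrow>\<^sub>0 'k"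
  let ?A = "\<lambda>i. row_param (\<lambda>_. v0) (i, v0) :: ('a, 'b) param"
  let ?B = "\<lambda>v. col_param (i0, v) :: ('a, 'b) param"
  define kill :: "('a, 'b) param set \<Rightarrow> ('a, 'b) param \<Rightarrow> (('a, 'b) param \<Rightarrow>\<^sub>0 nat) \<Rightarrow>\<^sub>0 'k"
    where "kill K w = (if w \<in> K then 0 else variable w)" for K w
  define \<sigma> :: "('a, 'b) param set \<Rightarrow> 'a \<times> 'b \<Rightarrow> (('a, 'b) param \<Rightarrow>\<^sub>0 nat) \<Rightarrow>\<^sub>0 'k"
    where "\<sigma> K x = poly_subst (kill K) (?\<tau> x)" for K x
  have \<sigma>_eq: "\<sigma> K (i, v) = kill K (?A i) * kill K (?B v)" for K i v
    unfolding \<sigma>_def toric_subst_def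
    by (simp add: poly_subst_mult row_param_def col_param_def)
  have step: "(subst_kernel V W (\<sigma> K), subst_kernel V W (\<sigma> (insert w K))) \<in> prime_step (matrix_poly_ring V W)"
    if "(i, v) \<in> V \<times> W" "w = ?A i \<or> w = ?B v" "?A i \<notin> K" "?B v \<notin> K" for K w i v
    by (rule subst_kernel_step[where t = "kill (insert w K)" and p = "variable (i, v)"])
      (use that in \<open>auto simp: \<sigma>_eq kill_def poly_subst_mult\<close>)
  \<comment> \<open>All column parameters except that of \<open>v0\<close> are killed first,
    witnessed by row \<open>i0\<close>. Keeping \<open>v0\<close> leaves one nonzero entry per row,
    so that each row parameter killed afterwards again makes an entry vanish.\<close>
  let ?K = "?B ` (W - {v0})"
  have "(subst_kernel V W (\<sigma> {}), subst_kernel V W (\<sigma> ?K)) \<in> prime_step (matrix_poly_ring V W) ^^ card ?K"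
  proof (rule set_indexed_chain[where P = "\<lambda>D. subst_kernel V W (\<sigma> D)"])
    fix D w assume "D \<subseteq> ?K" "w \<in> ?K - D"
    moreover from this obtain v where "v \<in> W" "w = ?B v" by blast
    ultimately show "(subst_kernel V W (\<sigma> D), subst_kernel V W (\<sigma> (insert w D))) \<in> prime_step (matrix_poly_ring V W)"
      using ne by (intro step[of i0 v]) auto
  qed (use fin in auto)
  moreover have "(subst_kernel V W (\<sigma> (?K \<union> {})), subst_kernel V W (\<sigma> (?K \<union> ?A ` V)))
      \<in> prime_step (matrix_poly_ring V W) ^^ card (?A ` V)"
  proof (rule set_indexed_chain[where P = "\<lambda>D. subst_kernel V W (\<sigma> (?K \<union> D))"])
    fix D w assume D: "D \<subseteq> ?A ` V" "w \<in> ?A ` V - D"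
    then obtain i where i: "i \<in> V" "w = ?A i" by blast
    have "?A i \<notin> ?K \<union> D" "?B v0 \<notin> ?K \<union> D" using D i by auto
    with i show "(subst_kernel V W (\<sigma> (?K \<union> D)), subst_kernel V W (\<sigma> (?K \<union> insert w D))) \<in> prime_step (matrix_poly_ring V W)"
      using ne D step[of i v0 w "?K \<union> D"] by auto
  qed (use fin in auto)
  ultimately have "(subst_kernel V W (\<sigma> {}), subst_kernel V W (\<sigma> (?K \<union> ?A ` V)))
      \<in> prime_step (matrix_poly_ring V W) ^^ (card ?K + card (?A ` V))"
    unfolding relpow_add by auto
  moreover have "subst_kernel V W (\<sigma> {}) = subst_kernel V W ?\<tau>"
  proof -
    have "\<sigma> {} x = ?\<tau> x" for x by (cases x) (simp add: \<sigma>_eq kill_def toric_subst_def row_param_def col_param_def)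
    then show ?thesis by presburger
  qed
  moreover have "subst_kernel V W (\<sigma> (?K \<union> ?A ` V)) = subst_kernel V W (\<lambda>_. 0 :: (('a, 'b) param \<Rightarrow>\<^sub>0 nat) \<Rightarrow>\<^sub>0 'k)"
  proof -
    have "poly_subst (\<sigma> (?K \<union> ?A ` V)) p = poly_subst (\<lambda>_. 0) p" if "p \<in> carrier (matrix_poly_ring V W)" for p
      using that by (rule poly_subst_cong) (auto simp: \<sigma>_eq kill_def)
    then show ?thesis unfolding subst_kernel_def by auto
  qed
  moreover have "card ?K + card (?A ` V) = card V + card W - 1"
  proof -
    have "card ?K = card (W - {v0})" by (rule card_image) (auto simp: inj_on_def)
    moreover have "card (?A ` V) = card V" by (rule card_image) (auto simp: inj_on_def)
    moreover have "card W > 0" using fin ne card_gt_0_iff by blast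
    ultimately show ?thesis using fin ne by (simp add: card_Diff_singleton)
  qed
  ultimately show ?thesis by simp
qed


section \<open>Generators of the toric primes\<close>

definition minor :: "'a \<Rightarrow> 'a \<Rightarrow> 'b \<Rightarrow> 'b \<Rightarrow> ('a, 'b, 'k::field) matrix_poly" where
  "minor i j t l = variable (i, t) * variable (j, l) - variable (i, l) * variable (j, t)"

lemma minor_closed [simp]:
  "i \<in> V \<Longrightarrow> j \<in> V \<Longrightarrow> t \<in> W \<Longrightarrow> l \<in> W \<Longrightarrow> minor i j t l \<in> carrier (matrix_poly_ring V W)"
  unfolding minor_def by (auto intro!: matrix_poly_ring_closed)

text \<open>The exponent vector of the image of \<open>m\<close> under \<open>toric_subst\<close>,
  as long as \<open>m\<close> avoids the columns of \<open>Z\<close>. It records the row sums of the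
  exponents within each block and the column sums.\<close>

definition toric_degree :: "('b \<Rightarrow> 'b) \<Rightarrow> ('a \<times> 'b \<Rightarrow>\<^sub>0 nat) \<Rightarrow> (('a, 'b) param \<Rightarrow>\<^sub>0 nat)" where
  "toric_degree rep m = (\<Sum>x\<in>Poly_Mapping.keys m.
     Poly_Mapping.single (row_param rep x) (Poly_Mapping.lookup m x) +
     Poly_Mapping.single (col_param x) (Poly_Mapping.lookup m x))"

lemma toric_degree_add: "toric_degree rep (m + m') = toric_degree rep m + toric_degree rep m'"
  unfolding toric_degree_def
  by (rule setsum_keys_plus_distrib[where f = "\<lambda>x n. Poly_Mapping.single (row_param rep x) n + Poly_Mapping.single (col_param x) n"])
    (auto simp: single_add ac_simps)

lemma toric_degree_single:
  "toric_degree rep (Poly_Mapping.single x 1) =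
    Poly_Mapping.single (row_param rep x) 1 + Poly_Mapping.single (col_param x) 1"
  by (simp add: toric_degree_def)

lemma toric_degree_zero [simp]: "toric_degree rep 0 = 0"
  by (simp add: toric_degree_def)

lemma sum_nat_pos_iff: "finite A \<Longrightarrow> 0 < sum f A \<longleftrightarrow> (\<exists>a\<in>A. 0 < (f a :: nat))"
  using sum_eq_0_iff[of A f] by (metis neq0_conv)

lemma toric_degree_row_pos:
  "0 < Poly_Mapping.lookup (toric_degree rep m) (row_param rep x) \<longleftrightarrow>
    (\<exists>y\<in>Poly_Mapping.keys m. fst y = fst x \<and> rep (snd y) = rep (snd x))"
  unfolding toric_degree_def lookup_sum sum_nat_pos_iff[OF finite_keys]
  by (intro bex_cong refl) (auto simp: lookup_add lookup_single when_def in_keys_iff)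

lemma toric_degree_col_pos:
  "0 < Poly_Mapping.lookup (toric_degree rep m) (col_param x) \<longleftrightarrow>
    (\<exists>y\<in>Poly_Mapping.keys m. snd y = snd x)"
  unfolding toric_degree_def lookup_sum sum_nat_pos_iff[OF finite_keys]
  by (intro bex_cong refl) (auto simp: lookup_add lookup_single when_def in_keys_iff)

lemma monomial_split:
  fixes m :: "'v \<Rightarrow>\<^sub>0 nat"
  assumes "x \<in> Poly_Mapping.keys m"
  obtains m' where "m = m' + Poly_Mapping.single x 1"
proof -
  have "m = (m - Poly_Mapping.single x 1) + Poly_Mapping.single x 1"
    using assms by (intro poly_mapping_eqI) (auto simp: lookup_add lookup_minus lookup_single when_def in_keys_iff)
  then show ?thesis by (rule that)
qed

definition total_degree :: "('v \<Rightarrow>\<^sub>0 nat) \<Rightarrow> nat" where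
  "total_degree m = (\<Sum>x\<in>Poly_Mapping.keys m. Poly_Mapping.lookup m x)"

lemma total_degree_add: "total_degree (m + m') = total_degree m + total_degree m'"
  unfolding total_degree_def by (rule setsum_keys_plus_distrib[where f = "\<lambda>x n. n"]) auto

lemma keys_add_nat:
  fixes m :: "'v \<Rightarrow>\<^sub>0 nat"
  shows "Poly_Mapping.keys (m + m') = Poly_Mapping.keys m \<union> Poly_Mapping.keys m'"
  by (auto simp: in_keys_iff lookup_add)

text \<open>Two monomials of the same degree share a variable after one exchange of columns
  \<open>x\<^sub>i\<^sub>v\<^sub>' x\<^sub>j\<^sub>v \<mapsto> x\<^sub>i\<^sub>v x\<^sub>j\<^sub>v\<^sub>'\<close> in the second one, and this exchange is a multiple of a minor.\<close>

lemma monomials_same_toric_degree: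
  fixes I :: "('a, 'b, 'k::field) matrix_poly set"
  assumes I: "ideal I (matrix_poly_ring V W)" and UW: "U \<subseteq> W"
    and minors: "\<And>i j t l. i \<in> V \<Longrightarrow> j \<in> V \<Longrightarrow> t \<in> U \<Longrightarrow> l \<in> U \<Longrightarrow> rep t = rep l \<Longrightarrow> minor i j t l \<in> I"
    and m: "Poly_Mapping.keys m \<subseteq> V \<times> U" and m': "Poly_Mapping.keys m' \<subseteq> V \<times> U"
    and eq: "toric_degree rep m = toric_degree rep m'"
  shows "Poly_Mapping.single m 1 - Poly_Mapping.single m' 1 \<in> I"
  using m m' eq
proof (induction "total_degree m" arbitrary: m m' rule: less_induct)
  case less
  note [simp] = keys_add_nat
  show ?case
  proof (cases "m = 0")
    case True
    have "m' = 0"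
    proof (rule ccontr)
      assume "m' \<noteq> 0"
      then obtain x where "x \<in> Poly_Mapping.keys m'" using keys_eq_empty by blast
      then have "0 < Poly_Mapping.lookup (toric_degree rep m') (col_param x)"
        unfolding toric_degree_col_pos by blast
      then show False using less.prems(3) True by simp
    qed
    with True show ?thesis using matrix_poly_ideal_closed(4)[OF I] by simp
  next
    case False
    then obtain x where x: "x \<in> Poly_Mapping.keys m" using keys_eq_empty by blast
    obtain i v where iv: "x = (i, v)" by force
    obtain m0 where m0: "m = m0 + Poly_Mapping.single x 1" using monomial_split[OF x] .
    have iV: "i \<in> V" "v \<in> U" using x iv less.prems(1) by auto
    have smaller: "total_degree m0 < total_degree m"
      unfolding m0 total_degree_add by (simp add: total_degree_def)
    \<comment> \<open>A common variable can be cancelled; the toric degrees of the quotients still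
      agree, and the total degree has dropped.\<close>
    have shared: "Poly_Mapping.single m 1 - Poly_Mapping.single m'' 1 \<in> I"
      if "m'' = m1 + Poly_Mapping.single x 1" "Poly_Mapping.keys m'' \<subseteq> V \<times> U"
        "toric_degree rep m'' = toric_degree rep m" for m'' m1
    proof -
      have "toric_degree rep m0 = toric_degree rep m1" using that m0 by (simp add: toric_degree_add)
      then have "Poly_Mapping.single m0 1 - Poly_Mapping.single m1 1 \<in> I"
        using less.hyps[OF smaller, of m1] less.prems m0 that by auto
      then have "(Poly_Mapping.single m0 1 - Poly_Mapping.single m1 1) * variable x \<in> I"
        using iv iV UW by (intro matrix_poly_ideal_closed(6)[OF I]) auto
      then show ?thesis using m0 that(1) by (simp add: variable_def left_diff_distrib mult_single)
    qed
    show ?thesis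
    proof (cases "x \<in> Poly_Mapping.keys m'")
      case True
      then obtain m1 where "m' = m1 + Poly_Mapping.single x 1" by (rule monomial_split)
      then show ?thesis using shared[of m' m1] less.prems by simp
    next
      case False
      \<comment> \<open>Equal row degrees yield a factor of \<open>m'\<close> in row
        \<open>i\<close> within the block of \<open>v\<close>, equal column degrees one in column
        \<open>v\<close>. As (i, v) itself does not occur in \<open>m'\<close>, these factors are
        different and can both be split off.\<close>
      have "0 < Poly_Mapping.lookup (toric_degree rep m') (row_param rep x)"
        using x less.prems(3) toric_degree_row_pos[of rep m x] by auto
      then obtain v' where v': "(i, v') \<in> Poly_Mapping.keys m'" "rep v' = rep v"
        unfolding toric_degree_row_pos iv by auto
      have "0 < Poly_Mapping.lookup (toric_degree rep m') (col_param x)"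
        using x less.prems(3) toric_degree_col_pos[of rep m x] by auto
      then obtain j where j: "(j, v) \<in> Poly_Mapping.keys m'"
        unfolding toric_degree_col_pos iv by auto
      obtain m1 where m1: "m' = m1 + Poly_Mapping.single (i, v') 1" using monomial_split[OF v'(1)] .
      have "(j, v) \<in> Poly_Mapping.keys m1"
        using j False m1 iv v' by (auto split: if_splits)
      then obtain m2 where m2: "m1 = m2 + Poly_Mapping.single (j, v) 1" by (rule monomial_split)
      define m'' where "m'' = (m2 + Poly_Mapping.single (j, v') 1) + Poly_Mapping.single x 1"
      have jV: "j \<in> V" "v' \<in> U" using j v' less.prems by auto
      have m2_keys: "Poly_Mapping.keys m2 \<subseteq> V \<times> U" using less.prems(2) m1 m2 by auto
      have "toric_degree rep m'' = toric_degree rep m'"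
        unfolding m''_def m1 m2 toric_degree_add toric_degree_single iv
        by (simp add: row_param_def col_param_def v'(2) ac_simps)
      then have "Poly_Mapping.single m 1 - Poly_Mapping.single m'' 1 \<in> I"
        using less.prems m2_keys iv iV jV by (intro shared[OF m''_def]) (auto simp: m''_def)
      moreover have "Poly_Mapping.single m'' 1 - Poly_Mapping.single m' 1 \<in> I"
      proof -
        have "Poly_Mapping.single m2 1 * minor i j v v' \<in> I"
          using minors[of i j v v'] iV jV v' m2_keys UW
          by (intro matrix_poly_ideal_closed(5)[OF I] matrix_poly_ring_single_closed) auto
        also have "Poly_Mapping.single m2 1 * minor i j v v' =
            (Poly_Mapping.single m'' 1 - Poly_Mapping.single m' 1 :: ('a, 'b, 'k) matrix_poly)"
          unfolding minor_def m''_def m1 m2 iv variable_def by (simp add: right_diff_distrib mult_single ac_simps)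
        finally show ?thesis .
      qed
      ultimately have "(Poly_Mapping.single m 1 - Poly_Mapping.single m'' 1) +
          (Poly_Mapping.single m'' 1 - Poly_Mapping.single m' 1) \<in> I"
        by (rule matrix_poly_ideal_closed(1)[OF I])
      then show ?thesis by simp
    qed
  qed
qed

lemma monomial_subst_toric:
  "monomial_subst (toric_subst Z rep) m =
    (if Poly_Mapping.keys m \<inter> (UNIV \<times> Z) = {} then Poly_Mapping.single (toric_degree rep m) 1
     else (0 :: _ \<Rightarrow>\<^sub>0 'k::field))"
proof (cases "Poly_Mapping.keys m \<inter> (UNIV \<times> Z) = {}")
  case True
  have pow: "Poly_Mapping.single u (1::'k) ^ n = Poly_Mapping.single (\<Sum>_<n. u) 1" for u :: "('a, 'b) param \<Rightarrow>\<^sub>0 nat" and n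
    by (induction n) (auto simp: mult_single add.commute)
  have *: "(\<Sum>_<n. Poly_Mapping.single w (Suc 0)) = Poly_Mapping.single w n" for w :: "('a, 'b) param" and n :: nat
    by (induction n) (auto simp: single_add[symmetric])
  have prod: "(\<Prod>x\<in>A. Poly_Mapping.single (f x) (1::'k)) = Poly_Mapping.single (sum f A) 1" if "finite A"
    for A :: "('a \<times> 'b) set" and f :: "_ \<Rightarrow> ('a, 'b) param \<Rightarrow>\<^sub>0 nat"
    using that by (induction A rule: finite_induct) (auto simp: mult_single)
  have "monomial_subst (toric_subst Z rep) m = (\<Prod>x\<in>Poly_Mapping.keys m. Poly_Mapping.single
      (Poly_Mapping.single (row_param rep x) (Poly_Mapping.lookup m x) +
       Poly_Mapping.single (col_param x) (Poly_Mapping.lookup m x)) (1::'k))"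
    unfolding monomial_subst_def using True
    by (intro prod.cong refl) (auto simp: toric_subst_def variable_mult pow sum.distrib *)
  then show ?thesis using True by (simp add: prod toric_degree_def)
next
  case False
  then obtain x where "x \<in> Poly_Mapping.keys m" "snd x \<in> Z" by auto
  then have "monomial_subst (toric_subst Z rep) m = (0 :: _ \<Rightarrow>\<^sub>0 'k)"
    unfolding monomial_subst_def
    by (intro prod_zero) (auto simp: toric_subst_def in_keys_iff zero_power intro!: bexI[of _ x])
  with False show ?thesis by simp
qed

text \<open>Straightening: modulo \<open>I\<close> every monomial meeting \<open>Z\<close> vanishes,
  and every other one may be replaced by a fixed representative of its toric degree. Membership in
  the kernel makes the coefficients sum to zero degree by degree, so nothing is left.
  \<open>I\<close> is arbitrary so that a colon ideal of \<open>J\<close> can be inserted.\<close>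

lemma toric_kernel_subset:
  fixes I :: "('a, 'b, 'k::field) matrix_poly set"
  assumes I: "ideal I (matrix_poly_ring V W)"
    and vars: "\<And>i v. i \<in> V \<Longrightarrow> v \<in> Z \<inter> W \<Longrightarrow> variable (i, v) \<in> I"
    and minors: "\<And>i j t l. i \<in> V \<Longrightarrow> j \<in> V \<Longrightarrow> t \<in> W - Z \<Longrightarrow> l \<in> W - Z \<Longrightarrow> rep t = rep l \<Longrightarrow> minor i j t l \<in> I"
  shows "subst_kernel V W (toric_subst Z rep) \<subseteq> I"
proof
  fix p :: "('a, 'b, 'k) matrix_poly" assume "p \<in> subst_kernel V W (toric_subst Z rep)"
  then have p: "p \<in> carrier (matrix_poly_ring V W)" "poly_subst (toric_subst Z rep) p = 0"
    unfolding subst_kernel_def by auto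
  have p_keys: "Poly_Mapping.keys m \<subseteq> V \<times> W" if "m \<in> Poly_Mapping.keys p" for m
    using p(1) that unfolding matrix_poly_ring_carrier by blast
  define K where "K = {m \<in> Poly_Mapping.keys p. Poly_Mapping.keys m \<inter> (UNIV \<times> Z) = {}}"
  have K: "finite K" "K \<subseteq> Poly_Mapping.keys p" unfolding K_def by auto
  have K_keys: "Poly_Mapping.keys m \<subseteq> V \<times> (W - Z)" if "m \<in> K" for m
    using that p_keys[of m] unfolding K_def by auto
  let ?c = "Poly_Mapping.lookup p"
  let ?d = "toric_degree rep :: ('a \<times> 'b \<Rightarrow>\<^sub>0 nat) \<Rightarrow> _"
  have killed: "Poly_Mapping.single m (?c m) \<in> I" if "m \<in> Poly_Mapping.keys p - K" for m
  proof -
    from that obtain i v where iv: "(i, v) \<in> Poly_Mapping.keys m" "v \<in> Z" unfolding K_def by auto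
    obtain m' where m': "m = m' + Poly_Mapping.single (i, v) 1" using monomial_split[OF iv(1)] .
    have iv: "i \<in> V" "v \<in> Z \<inter> W" using iv p_keys[of m] that by auto
    have "Poly_Mapping.single m' (?c m) * variable (i, v) \<in> I"
      using p_keys[of m] that m' iv
      by (intro matrix_poly_ideal_closed(5)[OF I] vars matrix_poly_ring_single_closed) (auto simp: keys_add_nat)
    then show ?thesis unfolding m' variable_def by (simp add: mult_single)
  qed
  define r where "r u = (SOME m. m \<in> K \<and> ?d m = u)" for u
  have r: "r (?d m) \<in> K" "?d (r (?d m)) = ?d m" if "m \<in> K" for m
    using someI[of "\<lambda>m'. m' \<in> K \<and> ?d m' = ?d m" m] that unfolding r_def by auto
  have straighten: "Poly_Mapping.single m (?c m) - Poly_Mapping.single (r (?d m)) (?c m) \<in> I" if "m \<in> K" for m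
  proof -
    have "Poly_Mapping.single m 1 - Poly_Mapping.single (r (?d m)) 1 \<in> I"
      using that r[OF that] K_keys minors
      by (intro monomials_same_toric_degree[OF I, of "W - Z" rep]) auto
    then have "const (?c m) * (Poly_Mapping.single m 1 - Poly_Mapping.single (r (?d m)) 1) \<in> I"
      by (intro matrix_poly_ideal_closed(5)[OF I]) auto
    then show ?thesis by (simp add: right_diff_distrib mult_single)
  qed
  have image: "(\<Sum>m\<in>K. Poly_Mapping.single (?d m) (?c m)) = 0"
  proof -
    have "poly_subst (toric_subst Z rep) p = (\<Sum>m\<in>Poly_Mapping.keys p. if m \<in> K then Poly_Mapping.single (?d m) (?c m) else 0)"
      unfolding poly_subst_def by (intro sum.cong) (auto simp: monomial_subst_toric mult_single K_def)
    also have "\<dots> = (\<Sum>m\<in>K. Poly_Mapping.single (?d m) (?c m))"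
      using K by (simp add: sum.inter_restrict[symmetric] Int_absorb1)
    finally show ?thesis using p(2) by simp
  qed
  have coeff: "(\<Sum>m | m \<in> K \<and> ?d m = u. ?c m) = 0" for u
  proof -
    have "(\<Sum>m\<in>K. if ?d m = u then ?c m else 0) = 0"
      using arg_cong[OF image, of "\<lambda>q. Poly_Mapping.lookup q u"]
      by (simp add: lookup_sum lookup_single when_def)
    then show ?thesis using K by (simp add: sum.If_cases Collect_conj_eq)
  qed
  have rest: "(\<Sum>m\<in>K. Poly_Mapping.single (r (?d m)) (?c m)) = 0"
  proof -
    have "(\<Sum>m\<in>K. Poly_Mapping.single (r (?d m)) (?c m)) =
        (\<Sum>u\<in>?d ` K. \<Sum>m | m \<in> K \<and> ?d m = u. Poly_Mapping.single (r (?d m)) (?c m))"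
      using sum.image_gen[OF K(1)] by blast
    also have "\<dots> = (\<Sum>u\<in>?d ` K. Poly_Mapping.single (r u) (\<Sum>m | m \<in> K \<and> ?d m = u. ?c m))"
    proof (rule sum.cong[OF refl])
      fix u
      have "Poly_Mapping.single (r u) (sum ?c A) = (\<Sum>m\<in>A. Poly_Mapping.single (r u) (?c m))" for A
        by (induction A rule: infinite_finite_induct) (auto simp: single_add)
      then show "(\<Sum>m | m \<in> K \<and> ?d m = u. Poly_Mapping.single (r (?d m)) (?c m)) =
          Poly_Mapping.single (r u) (\<Sum>m | m \<in> K \<and> ?d m = u. ?c m)" by simp
    qed
    also have "\<dots> = 0" by (simp add: coeff)
    finally show ?thesis .
  qed
  have "p = (\<Sum>m\<in>Poly_Mapping.keys p. Poly_Mapping.single m (?c m))" by (rule poly_mapping_sum_singles)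
  also have "\<dots> = (\<Sum>m\<in>Poly_Mapping.keys p - K. Poly_Mapping.single m (?c m)) + (\<Sum>m\<in>K. Poly_Mapping.single m (?c m))"
    using K by (intro sum.subset_diff) auto
  also have "(\<Sum>m\<in>K. Poly_Mapping.single m (?c m)) =
      (\<Sum>m\<in>K. Poly_Mapping.single m (?c m) - Poly_Mapping.single (r (?d m)) (?c m))"
    by (simp add: sum_subtractf rest)
  also have "(\<Sum>m\<in>Poly_Mapping.keys p - K. Poly_Mapping.single m (?c m)) +
      (\<Sum>m\<in>K. Poly_Mapping.single m (?c m) - Poly_Mapping.single (r (?d m)) (?c m)) \<in> I"
    by (intro matrix_poly_ideal_closed(1)[OF I] matrix_poly_ideal_sum[OF I] killed straighten)
  finally show "p \<in> I" .
qed


section \<open>Primes in quotients\<close>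

lemma relpow_map:
  assumes "\<And>x y. (x, y) \<in> r \<Longrightarrow> (f x, f y) \<in> s" "(x, y) \<in> r ^^ n"
  shows "(f x, f y) \<in> s ^^ n"
  using assms(2)
proof (induction n arbitrary: y)
  case (Suc n)
  then obtain z where "(x, z) \<in> r ^^ n" "(z, y) \<in> r" by auto
  then show ?case using Suc.IH assms(1) by (auto intro: relcompI)
qed simp

lemma prime_step_relpow_mono: "(P, Q) \<in> prime_step R ^^ n \<Longrightarrow> P \<subseteq> Q"
proof (induction n arbitrary: Q)
  case (Suc n)
  then obtain T where "(P, T) \<in> prime_step R ^^ n" "(T, Q) \<in> prime_step R" by auto
  then show ?case using Suc.IH unfolding prime_step_def by blast
qed simp

context ring_hom_cring
begin

lemma as_ring_hom_ring: "ring_hom_ring R S h"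
  by (rule ring_hom_ringI2[OF R.ring_axioms S.ring_axioms homh])

text \<open>Two elements with equal image differ by an element of the kernel, which \<open>P\<close>
  contains. This is the part of the correspondence between ideals that the transfer of primes to a
  quotient rests on.\<close>

lemma image_mem_iff:
  assumes "ideal P R" "\<And>a. a \<in> carrier R \<Longrightarrow> h a = \<zero>\<^bsub>S\<^esub> \<Longrightarrow> a \<in> P" "a \<in> carrier R"
  shows "h a \<in> h ` P \<longleftrightarrow> a \<in> P"
proof
  interpret P: ideal P R by fact
  assume "h a \<in> h ` P"
  then obtain p where p: "p \<in> P" "h a = h p" by auto
  then have pc: "p \<in> carrier R" by simp
  have "h (a \<ominus> p) = \<zero>\<^bsub>S\<^esub>"
    using assms(3) pc p by (simp add: R.minus_eq S.r_neg)
  then have "a \<ominus> p \<in> P" using assms pc by simp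
  then have "(a \<ominus> p) \<oplus> p \<in> P" using p by simp
  then show "a \<in> P" using assms(3) pc by (simp add: R.minus_eq R.add.m_assoc R.l_neg)
qed simp

lemma image_prime:
  assumes surj: "h ` carrier R = carrier S" and P: "primeideal P R"
    and ker: "\<And>a. a \<in> carrier R \<Longrightarrow> h a = \<zero>\<^bsub>S\<^esub> \<Longrightarrow> a \<in> P"
  shows "primeideal (h ` P) S"
proof -
  interpret P: primeideal P R by fact
  note iff = image_mem_iff[OF P.is_ideal ker]
  have lift: "\<exists>x\<in>carrier R. y = h x" if "y \<in> carrier S" for y
    using that unfolding surj[symmetric] by blast
  show ?thesis
  proof (rule primeidealI)
    show "ideal (h ` P) S"
    proof (rule idealI[OF S.ring_axioms])
      show "subgroup (h ` P) (add_monoid S)"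
        using ring_hom_ring.img_is_add_subgroup[OF as_ring_hom_ring P.a_subgroup] .
    next
      fix a x assume ax: "a \<in> h ` P" "x \<in> carrier S"
      obtain p where p: "p \<in> P" "a = h p" using ax(1) by (rule imageE)
      obtain y where y: "y \<in> carrier R" "x = h y" using lift[OF ax(2)] by (rule bexE)
      note * = p y
      moreover have "p \<in> carrier R" using *(1) by (rule P.Icarr)
      ultimately have "x \<otimes>\<^bsub>S\<^esub> a = h (y \<otimes> p)" "a \<otimes>\<^bsub>S\<^esub> x = h (p \<otimes> y)" by simp_all
      then show "x \<otimes>\<^bsub>S\<^esub> a \<in> h ` P" "a \<otimes>\<^bsub>S\<^esub> x \<in> h ` P"
        using imageI[OF P.I_l_closed[OF p(1) y(1)], of h] imageI[OF P.I_r_closed[OF p(1) y(1)], of h]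
        by simp_all
    qed
    show "carrier S \<noteq> h ` P"
    proof
      assume "carrier S = h ` P"
      then have "h \<one> \<in> h ` P" using hom_closed[OF R.one_closed] by metis
      then show False using iff[of \<one>] P.one_imp_carrier P.I_notcarr by simp
    qed
  next
    fix a b assume a: "a \<in> carrier S" and b: "b \<in> carrier S" and ab: "a \<otimes>\<^bsub>S\<^esub> b \<in> h ` P"
    obtain x where x: "x \<in> carrier R" "a = h x" using lift[OF a] by (rule bexE)
    obtain y where y: "y \<in> carrier R" "b = h y" using lift[OF b] by (rule bexE)
    note * = x y
    then have "h (x \<otimes> y) \<in> h ` P" using ab by simp
    then have "x \<otimes> y \<in> P" using iff[of "x \<otimes> y"] * by simp
    then have "x \<in> P \<or> y \<in> P" using P.I_prime x(1) y(1) by simp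
    then show "a \<in> h ` P \<or> b \<in> h ` P" using x(2) y(2) by blast
  qed (rule S.is_cring)
qed

text \<open>Containing the kernel is asked of the lowest prime only, since the other primes of the
  chain inherit it.\<close>

lemma image_prime_chain:
  assumes surj: "h ` carrier R = carrier S"
    and ker: "\<And>a. a \<in> carrier R \<Longrightarrow> h a = \<zero>\<^bsub>S\<^esub> \<Longrightarrow> a \<in> P"
    and chain: "(P, Q) \<in> prime_step R ^^ n"
  shows "(h ` P, h ` Q) \<in> prime_step S ^^ n"
  using chain
proof (induction n arbitrary: Q)
  case (Suc n)
  then obtain T where T: "(P, T) \<in> prime_step R ^^ n" "(T, Q) \<in> prime_step R" by auto
  then have PT: "P \<subseteq> T" "T \<subset> Q" "primeideal T R" "primeideal Q R"
    using prime_step_relpow_mono unfolding prime_step_def by blast+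
  then have kT: "a \<in> T" "a \<in> Q" if "a \<in> carrier R" "h a = \<zero>\<^bsub>S\<^esub>" for a using ker that by blast+
  obtain q where q: "q \<in> Q" "q \<notin> T" using PT by blast
  have "q \<in> carrier R" by (rule ideal.Icarr[OF primeideal.axioms(1)[OF PT(4)] q(1)])
  then have "h q \<notin> h ` T" using image_mem_iff[OF primeideal.axioms(1)[OF PT(3)] kT(1)] q by blast
  then have "(h ` T, h ` Q) \<in> prime_step S"
    using image_prime[OF surj PT(3) kT(1)] image_prime[OF surj PT(4) kT(2)] q PT
    unfolding prime_step_def by blast
  then show ?case using Suc.IH[OF T(1)] by auto
qed simp

lemma vimage_prime_chain:
  assumes surj: "h ` carrier R = carrier S"
    and chain: "(P, Q) \<in> prime_step S ^^ n"
  shows "({r \<in> carrier R. h r \<in> P}, {r \<in> carrier R. h r \<in> Q}) \<in> prime_step R ^^ n"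
proof (rule relpow_map[where f = "\<lambda>P. {r \<in> carrier R. h r \<in> P}", OF _ chain])
  fix P Q assume "(P, Q) \<in> prime_step S"
  then have PQ: "primeideal P S" "primeideal Q S" "P \<subset> Q" unfolding prime_step_def by auto
  then obtain q where q: "q \<in> Q" "q \<notin> P" by blast
  have "q \<in> carrier S" by (rule ideal.Icarr[OF primeideal.axioms(1)[OF PQ(2)] q(1)])
  then obtain r where "r \<in> carrier R" "q = h r" unfolding surj[symmetric] by (rule imageE)
  then have "{r \<in> carrier R. h r \<in> P} \<subset> {r \<in> carrier R. h r \<in> Q}" using PQ(3) q by blast
  then show "({r \<in> carrier R. h r \<in> P}, {r \<in> carrier R. h r \<in> Q}) \<in> prime_step R"
    using ring_hom_ring.primeideal_vimage[OF as_ring_hom_ring R.is_cring PQ(1)] ring_hom_ring.primeideal_vimage[OF as_ring_hom_ring R.is_cring PQ(2)]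
    unfolding prime_step_def by simp
qed

lemma image_maximal:
  assumes surj: "h ` carrier R = carrier S" and M: "maximalideal M R"
    and ker: "\<And>a. a \<in> carrier R \<Longrightarrow> h a = \<zero>\<^bsub>S\<^esub> \<Longrightarrow> a \<in> M"
  shows "maximalideal (h ` M) S"
proof -
  interpret M: maximalideal M R by fact
  have prime: "primeideal (h ` M) S"
    using image_prime[OF surj R.maximalideal_prime[OF M] ker] .
  show ?thesis
  proof (rule maximalidealI)
    show "ideal (h ` M) S" using prime by (rule primeideal.axioms(1))
    show "carrier S \<noteq> h ` M" using prime unfolding primeideal_def primeideal_axioms_def by blast
  next
    fix I assume I: "ideal I S" "h ` M \<subseteq> I" "I \<subseteq> carrier S"
    let ?I = "{r \<in> carrier R. h r \<in> I}"
    have "I = h ` ?I" using I(3) surj by auto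
    moreover have "?I = M \<or> ?I = carrier R"
      using M.I_maximal[of ?I] ring_hom_ring.ideal_vimage[OF as_ring_hom_ring I(1)] I(2) M.Icarr by blast
    ultimately show "I = h ` M \<or> I = carrier S" using surj by metis
  qed
qed

end

section \<open>Height bounds read off from chains\<close>

lemma prime_height_ge:
  assumes "(Q, P) \<in> prime_step R ^^ n" "primeideal P R"
  shows "enat n \<le> prime_height R P"
proof -
  obtain F where F: "F 0 = Q" "F n = P" "\<And>i. i < n \<Longrightarrow> (F i, F (Suc i)) \<in> prime_step R"
    using assms(1) unfolding relpow_fun_conv by blast
  have "primeideal (F i) R" if "i \<le> n" for i
    using F assms(2) that unfolding prime_step_def by (cases "i = n") auto
  then show ?thesis
    unfolding prime_height_def using F by (intro Sup_upper) (auto simp: prime_step_def)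
qed

lemma prime_height_le:
  assumes "\<And>n Q. (Q, P) \<in> prime_step R ^^ n \<Longrightarrow> n \<le> N"
  shows "prime_height R P \<le> enat N"
  unfolding prime_height_def
proof (rule Sup_least, clarify)
  fix n F assume F: "\<forall>i\<le>n. primeideal (F i) R" "\<forall>i<n. F i \<subset> F (Suc i)" "P = F n"
  then have "(F 0, F n) \<in> prime_step R ^^ n"
    unfolding relpow_fun_conv prime_step_def by (intro exI[of _ F]) auto
  then show "enat n \<le> enat N" using assms F(3) by auto
qed


section \<open>Associated primes\<close>

text \<open>Abstracts from the vertex orders: \<open>J\<close> is the least ideal containing the
  minors of all arcs, not only of those with i < j and t < l, so that paths can be followed without
  regard to the order of their vertices.\<close>

locale edge_minors =
  fixes V :: "'a::linorder set" and W :: "'b::linorder set"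
    and E1 :: "'a rel" and E2 :: "'b rel" and J :: "('a, 'b, 'k::field) matrix_poly set"
  assumes finite_V: "finite V" and finite_W: "finite W"
    and E1: "E1 \<subseteq> V \<times> V" "\<And>i. (i, i) \<notin> E1" "\<And>i j. i \<in> V \<Longrightarrow> j \<in> V \<Longrightarrow> (i, j) \<in> E1\<^sup>*"
    and card_V: "card V \<ge> 2"
    and E2: "E2 \<subseteq> W \<times> W"
    and J_ideal: "ideal J (matrix_poly_ring V W)"
    and J_minor: "\<And>i j t l. (i, j) \<in> E1 \<Longrightarrow> (t, l) \<in> E2 \<Longrightarrow> minor i j t l \<in> J"
    and J_least: "\<And>I. ideal I (matrix_poly_ring V W) \<Longrightarrow>
      (\<And>i j t l. (i, j) \<in> E1 \<Longrightarrow> (t, l) \<in> E2 \<Longrightarrow> minor i j t l \<in> I) \<Longrightarrow> J \<subseteq> I"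
begin

abbreviation S :: "('a, 'b, 'k) matrix_poly ring" where
  "S \<equiv> matrix_poly_ring V W"

abbreviation toric_prime :: "'b set \<Rightarrow> ('b \<Rightarrow> 'b) \<Rightarrow> ('a, 'b, 'k) matrix_poly set" where
  "toric_prime Z rep \<equiv> subst_kernel V W (toric_subst Z rep)"

lemma E1_neighbour:
  assumes "i \<in> V"
  obtains j where "(i, j) \<in> E1" "j \<in> V" "i \<noteq> j"
proof -
  have "V \<noteq> {i}" using card_V by auto
  then obtain k where "k \<in> V" "k \<noteq> i" using assms by blast
  then obtain j where "(i, j) \<in> E1" using E1(3)[OF assms, of k] by (metis converse_rtranclE)
  then show ?thesis using that E1(1,2) by blast
qed

lemma toric_prime_contains:
  assumes edge: "\<And>t l. (t, l) \<in> E2 \<Longrightarrow> t \<notin> Z \<Longrightarrow> l \<notin> Z \<Longrightarrow> rep t = rep l"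
  shows "J \<subseteq> toric_prime Z rep"
proof (rule J_least)
  show "ideal (toric_prime Z rep) S" using subst_kernel_prime by (rule primeideal.axioms(1))
next
  fix i j t l assume *: "(i, j) \<in> E1" "(t, l) \<in> E2"
  have "poly_subst (toric_subst Z rep) (minor i j t l) = 0"
  proof (cases "t \<in> Z \<or> l \<in> Z")
    case True
    then show ?thesis
      by (auto simp: minor_def poly_subst_diff poly_subst_mult toric_subst_def)
  next
    case False
    then have "rep t = rep l" using edge * by blast
    then show ?thesis using False
      by (simp add: minor_def poly_subst_diff poly_subst_mult toric_subst_def row_param_def col_param_def)
  qed
  then show "minor i j t l \<in> toric_prime Z rep"
    unfolding subst_kernel_def using subsetD[OF E1(1) *(1)] subsetD[OF E2 *(2)] by simp
qed

text \<open>Only one of the two monomials involves the parameter of row \<open>i\<close> in the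
  block of \<open>t\<close>. Minors across blocks are thus local units, which later puts the
  variables of the columns \<open>Z\<close> into the localized ideal.\<close>

lemma minor_notin_toric_prime:
  assumes "i \<noteq> j" "rep t \<noteq> rep l" "t \<notin> Z" "l \<notin> Z"
  shows "minor i j t l \<notin> toric_prime Z rep"
proof -
  let ?e = "\<lambda>x. Poly_Mapping.single (row_param rep x) 1 + Poly_Mapping.single (col_param x) 1 :: ('a, 'b) param \<Rightarrow>\<^sub>0 nat"
  let ?m = "?e (i, t) + ?e (j, l)" and ?m' = "?e (i, l) + ?e (j, t)"
  have "Poly_Mapping.lookup ?m (row_param rep (i, t)) \<noteq> Poly_Mapping.lookup ?m' (row_param rep (i, t))"
    using assms by (simp add: lookup_add lookup_single)
  then have "?m \<noteq> ?m'" by metis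
  moreover have "poly_subst (toric_subst Z rep) (minor i j t l) =
      Poly_Mapping.single ?m 1 - Poly_Mapping.single ?m' (1::'k)"
    using assms by (simp add: minor_def poly_subst_diff poly_subst_mult toric_subst_def)
      (simp add: variable_def mult_single)
  ultimately have "poly_subst (toric_subst Z rep) (minor i j t l :: ('a, 'b, 'k) matrix_poly) \<noteq> 0"
    using single_diff_nonzero[of ?m ?m'] by simp
  then show ?thesis unfolding subst_kernel_def by simp
qed

text \<open>The contraction to \<open>S\<close> of the localization of \<open>J\<close> at \<open>P\<close>.\<close>

definition locally_in :: "('a, 'b, 'k) matrix_poly set \<Rightarrow> ('a, 'b, 'k) matrix_poly set" where
  "locally_in P = {p \<in> carrier S. \<exists>u\<in>carrier S - P. u * p \<in> J}"

lemma prime_mult_notin: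
  assumes "primeideal P S" "u \<in> carrier S - P" "v \<in> carrier S - P"
  shows "u * v \<in> carrier S - P"
  using assms primeideal.I_prime[OF assms(1), of u v] by (auto simp: matrix_poly_ring_closed)

lemma prime_one_notin:
  assumes "primeideal P S"
  shows "1 \<in> carrier S - P"
proof -
  interpret primeideal P S by fact
  show ?thesis using one_imp_carrier I_notcarr one_closed by auto
qed

lemma locally_in_ideal:
  assumes P: "primeideal P S"
  shows "ideal (locally_in P) S"
proof -
  interpret cring S by (rule matrix_poly_ring_cring)
  note J = matrix_poly_ideal_closed[OF J_ideal]
  show ?thesis
  proof (rule idealI[OF ring_axioms])
    show "subgroup (locally_in P) (add_monoid S)"
    proof (rule add.subgroupI)
      have "0 \<in> locally_in P"
        unfolding locally_in_def using prime_one_notin[OF P] J(4) zero_closed by force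
      then show "locally_in P \<noteq> {}" by auto
      fix a assume "a \<in> locally_in P"
      then obtain u where u: "a \<in> carrier S" "u \<in> carrier S - P" "u * a \<in> J"
        unfolding locally_in_def by auto
      then show "\<ominus>\<^bsub>S\<^esub> a \<in> locally_in P"
        unfolding locally_in_def using J(3)[OF u(3)] by (auto intro: matrix_poly_ring_closed)
      fix b assume "b \<in> locally_in P"
      then obtain v where v: "b \<in> carrier S" "v \<in> carrier S - P" "v * b \<in> J"
        unfolding locally_in_def by auto
      have "(u * v) * (a + b) = v * (u * a) + u * (v * b)" by (simp add: algebra_simps)
      also have "\<dots> \<in> J" using u v J by auto
      finally show "a \<oplus>\<^bsub>S\<^esub> b \<in> locally_in P"
        unfolding locally_in_def using prime_mult_notin[OF P u(2) v(2)] u v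
        by (auto intro: matrix_poly_ring_closed)
    qed (auto simp: locally_in_def)
  next
    fix a x assume "a \<in> locally_in P" and x: "x \<in> carrier S"
    then obtain u where u: "a \<in> carrier S" "u \<in> carrier S - P" "u * a \<in> J"
      unfolding locally_in_def by auto
    have "u * (x * a) = x * (u * a)" by simp
    then have "u * (x * a) \<in> J" using J(5)[OF u(3) x] by metis
    then show "x \<otimes>\<^bsub>S\<^esub> a \<in> locally_in P" "a \<otimes>\<^bsub>S\<^esub> x \<in> locally_in P"
      unfolding locally_in_def using u x by (auto simp: mult.commute intro: matrix_poly_ring_closed)
  qed
qed

lemma locally_in_J:
  assumes "primeideal P S" "p \<in> J"
  shows "p \<in> locally_in P"
  unfolding locally_in_def
  using prime_one_notin[OF assms(1)] matrix_poly_ideal_closed(7)[OF J_ideal assms(2)] assms(2)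
  by force

lemma locally_in_cancel:
  assumes "primeideal P S" "y * p \<in> locally_in P" "y \<in> carrier S - P" "p \<in> carrier S"
  shows "p \<in> locally_in P"
proof -
  obtain u where u: "u \<in> carrier S - P" "u * (y * p) \<in> J"
    using assms(2) unfolding locally_in_def by auto
  then show ?thesis
    unfolding locally_in_def using prime_mult_notin[OF assms(1) u(1) assms(3)] assms(4)
    by (auto simp: mult.assoc intro!: bexI[of _ "u * y"])
qed

text \<open>Clears denominators: the product of the individual multipliers serves all of
  \<open>A\<close>. For a finite generating set of the prime it becomes the element \<open>f\<close>
  of the desired colon ideal.\<close>

lemma finite_locally_in:
  assumes P: "primeideal P S" and "finite A" "A \<subseteq> locally_in P"
  obtains u where "u \<in> carrier S - P" "\<And>a. a \<in> A \<Longrightarrow> u * a \<in> J"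
  using assms(2,3)
proof (induction A arbitrary: thesis rule: finite_induct)
  case empty
  then show ?case using prime_one_notin[OF P] by blast
next
  case (insert a A)
  obtain u where u: "u \<in> carrier S - P" "\<And>a. a \<in> A \<Longrightarrow> u * a \<in> J" using insert by blast
  obtain v where v: "v \<in> carrier S - P" "v * a \<in> J" using insert.prems unfolding locally_in_def by auto
  have "(v * u) * b \<in> J" if "b \<in> insert a A" for b
  proof (cases "b = a")
    case True
    have eq: "(v * u) * a = u * (v * a)" by (simp only: ac_simps)
    have "u \<in> carrier S" using u(1) by blast
    then show ?thesis unfolding True eq by (rule matrix_poly_ideal_closed(5)[OF J_ideal v(2)])
  next
    case False
    then have b: "b \<in> A" using that by blast
    have "v \<in> carrier S" using v(1) by blast
    then show ?thesis
      unfolding mult.assoc by (rule matrix_poly_ideal_closed(5)[OF J_ideal u(2)[OF b]])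
  qed
  then show ?case using insert.prems(1) prime_mult_notin[OF P v(1) u(1)] by blast
qed

text \<open>Where \<open>variable (j, t)\<close> is a local unit, membership of minors passes along
  a path of rows; the next identity does the same for columns.\<close>

lemma minor_rows_trans:
  "variable (j, t) * minor i k t l = variable (i, t) * minor j k t l + variable (k, t) * minor i j t l"
  unfolding minor_def by (simp add: algebra_simps)

lemma minor_cols_trans:
  "variable (i, l) * minor i j t u = variable (i, t) * minor i j l u + variable (i, u) * minor i j t l"
  unfolding minor_def by (simp add: algebra_simps)

text \<open>The hypotheses have separate purposes. \<open>edge\<close> places \<open>J\<close>
  inside the prime, \<open>conn\<close> brings the minors of each block into the localized ideal by
  following paths, and \<open>cut\<close> does so for the variables of the columns in
  \<open>Z\<close>, each adjacent to two different blocks.\<close>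

theorem toric_prime_associated:
  assumes edge: "\<And>t l. (t, l) \<in> E2 \<Longrightarrow> t \<notin> Z \<Longrightarrow> l \<notin> Z \<Longrightarrow> rep t = rep l"
    and conn: "\<And>t l. t \<in> W - Z \<Longrightarrow> l \<in> W - Z \<Longrightarrow> rep t = rep l \<Longrightarrow> (t, l) \<in> (E2 \<inter> (- Z) \<times> (- Z))\<^sup>*"
    and cut: "\<And>t. t \<in> Z \<inter> W \<Longrightarrow> \<exists>a\<in>W - Z. \<exists>b\<in>W - Z. rep a \<noteq> rep b \<and> (t, a) \<in> E2 \<and> (t, b) \<in> E2"
  shows "\<exists>f\<in>carrier S. toric_prime Z rep = colon S J f"
proof -
  let ?P = "toric_prime Z rep"
  have P: "primeideal ?P S" by (rule subst_kernel_prime)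
  note L = matrix_poly_ideal_closed[OF locally_in_ideal[OF P]]
  have x_notin: "variable (i, v) \<in> carrier S - ?P" if "i \<in> V" "v \<in> W - Z" for i v
    using that by (simp add: subst_kernel_def toric_subst_def)
  have rows: "minor i j t l \<in> locally_in ?P"
    if ij: "(i, j) \<in> E1\<^sup>*" "i \<in> V" and tl: "(t, l) \<in> E2 \<inter> (- Z) \<times> (- Z)" for i j t l
    using ij
  proof (induction rule: rtrancl_induct)
    case base
    then show ?case using L(4) by (simp add: minor_def)
  next
    case (step j k)
    then have V: "i \<in> V" "j \<in> V" "k \<in> V" and W: "t \<in> W" "l \<in> W" using E1(1) E2 tl by auto
    have "minor j k t l \<in> locally_in ?P" using J_minor step tl by (intro locally_in_J[OF P]) auto
    then have "variable (j, t) * minor i k t l \<in> locally_in ?P"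
      using step V W by (subst minor_rows_trans, intro L(1,5)) auto
    then show ?case using x_notin V W tl by - (rule locally_in_cancel[OF P, of "variable (j, t)"], auto)
  qed
  have cols: "minor i j t l \<in> locally_in ?P"
    if tl: "(t, l) \<in> (E2 \<inter> (- Z) \<times> (- Z))\<^sup>*" "t \<in> W - Z" and ij: "i \<in> V" "j \<in> V" for i j t l
    using tl
  proof (induction rule: rtrancl_induct)
    case base
    then show ?case using L(4) by (simp add: minor_def)
  next
    case (step l u)
    then have W: "t \<in> W" "l \<in> W - Z" "u \<in> W" using E2 tl by auto
    have "minor i j l u \<in> locally_in ?P" using rows[OF E1(3)[OF ij]] step ij by blast
    then have "variable (i, l) * minor i j t u \<in> locally_in ?P"
      using step W ij by (subst minor_cols_trans, intro L(1,5)) auto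
    then show ?case using x_notin ij W by - (rule locally_in_cancel[OF P, of "variable (i, l)"], auto)
  qed
  have vars: "variable (i, t) \<in> locally_in ?P" if it: "i \<in> V" "t \<in> Z \<inter> W" for i t
  proof -
    obtain j where j: "(i, j) \<in> E1" "j \<in> V" "i \<noteq> j" using E1_neighbour[OF \<open>i \<in> V\<close>] .
    obtain a b where ab: "a \<in> W - Z" "b \<in> W - Z" "rep a \<noteq> rep b" "(t, a) \<in> E2" "(t, b) \<in> E2"
      using cut[OF it(2)] by blast
    \<comment> \<open>The terms containing x_jt cancel. Both minors on the right belong to arcs at
      \<open>t\<close>, while the minor on the left crosses two blocks and is therefore a local
      unit.\<close>
    have "minor i j b a * variable (i, t) = variable (i, b) * minor i j t a - variable (i, a) * minor i j t b"
      unfolding minor_def by (simp add: algebra_simps)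
    also have "\<dots> \<in> locally_in ?P"
      using j ab \<open>i \<in> V\<close> by (intro L(2,5) locally_in_J[OF P] J_minor) auto
    finally show ?thesis
      using minor_notin_toric_prime[of i j rep b a Z] j ab that
      by - (rule locally_in_cancel[OF P, of "minor i j b a"], auto)
  qed
  \<comment> \<open>The generators that \<open>toric_kernel_subset\<close> asks for. There are
    finitely many, so a single \<open>f\<close> outside the prime multiplies all of them into
    \<open>J\<close>.\<close>
  define A :: "('a, 'b, 'k) matrix_poly set" where "A = (\<lambda>x. variable x) ` (V \<times> (Z \<inter> W)) \<union>
    (\<lambda>(i, j, t, l). minor i j t l) ` (V \<times> V \<times> (SIGMA t : W - Z. {l \<in> W - Z. rep t = rep l}))"
  have "finite A" unfolding A_def using finite_V finite_W by auto
  moreover have "A \<subseteq> locally_in ?P"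
    unfolding A_def using vars cols conn by auto
  ultimately obtain f where f: "f \<in> carrier S - ?P" "\<And>a. a \<in> A \<Longrightarrow> f * a \<in> J"
    using finite_locally_in[OF P] by blast
  interpret cring S by (rule matrix_poly_ring_cring)
  have "?P \<subseteq> colon S J f"
  proof (rule toric_kernel_subset)
    show "ideal (colon S J f) S" using colon_ideal[OF J_ideal] f by blast
  next
    fix i v assume "i \<in> V" "v \<in> Z \<inter> W"
    then have "variable (i, v) \<in> A" unfolding A_def by blast
    then show "variable (i, v) \<in> colon S J f"
      using f(2)[of "variable (i, v)"] \<open>i \<in> V\<close> \<open>v \<in> Z \<inter> W\<close>
      by (simp add: colon_def mult.commute[of _ f])
  next
    fix i j t l assume *: "i \<in> V" "j \<in> V" "t \<in> W - Z" "l \<in> W - Z" "rep t = rep l"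
    then have "(i, j, t, l) \<in> V \<times> V \<times> (SIGMA t : W - Z. {l \<in> W - Z. rep t = rep l})" by simp
    then have "(\<lambda>(i, j, t, l). minor i j t l) (i, j, t, l) \<in> A" unfolding A_def by (intro UnI2 imageI)
    then show "minor i j t l \<in> colon S J f"
      using f(2)[of "minor i j t l"] * by (simp add: colon_def mult.commute[of _ f])
  qed
  moreover have JP: "J \<subseteq> ?P" using edge by (rule toric_prime_contains)
  have "colon S J f \<subseteq> ?P"
  proof
    fix g assume "g \<in> colon S J f"
    then have "g \<in> carrier S" "g * f \<in> ?P"
      using JP unfolding colon_def by auto
    then show "g \<in> ?P" using f(1) primeideal.I_prime[OF P, of g f] by auto
  qed
  ultimately show ?thesis using f(1) by blast
qed

end


section \<open>The origin\<close>

lemma poly_subst_at_zero: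
  fixes p :: "('v \<Rightarrow>\<^sub>0 nat) \<Rightarrow>\<^sub>0 'k::field"
  shows "poly_subst (\<lambda>_. 0 :: ('w \<Rightarrow>\<^sub>0 nat) \<Rightarrow>\<^sub>0 'k) p = const (Poly_Mapping.lookup p 0)"
proof -
  have "monomial_subst (\<lambda>_. 0 :: ('w \<Rightarrow>\<^sub>0 nat) \<Rightarrow>\<^sub>0 'k) m = 0" if "m \<noteq> 0" for m :: "'v \<Rightarrow>\<^sub>0 nat"
  proof -
    have "Poly_Mapping.keys m \<noteq> {}" using that by simp
    then obtain x where x: "x \<in> Poly_Mapping.keys m" by blast
    then have "0 ^ Poly_Mapping.lookup m x = (0 :: ('w \<Rightarrow>\<^sub>0 nat) \<Rightarrow>\<^sub>0 'k)"
      by (intro zero_power) (simp add: in_keys_iff)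
    then show ?thesis unfolding monomial_subst_def using x by (intro prod_zero) auto
  qed
  then have "poly_subst (\<lambda>_. 0 :: ('w \<Rightarrow>\<^sub>0 nat) \<Rightarrow>\<^sub>0 'k) p =
      (\<Sum>m\<in>Poly_Mapping.keys p. if m = 0 then const (Poly_Mapping.lookup p 0) else 0)"
    unfolding poly_subst_def by (intro sum.cong refl) simp
  also have "\<dots> = const (Poly_Mapping.lookup p 0)"
    by (cases "0 \<in> Poly_Mapping.keys p") (simp_all add: sum.delta[OF finite_keys] in_keys_iff)
  finally show ?thesis .
qed

lemma origin_maximal:
  "maximalideal (subst_kernel V W (\<lambda>_. 0 :: ('w::linorder \<Rightarrow>\<^sub>0 nat) \<Rightarrow>\<^sub>0 'k::field)) (matrix_poly_ring V W)"
  (is "maximalideal ?M ?S")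
proof -
  have prime: "primeideal ?M ?S" by (rule subst_kernel_prime)
  interpret primeideal ?M ?S by fact
  have "const c = (0 :: ('w \<Rightarrow>\<^sub>0 nat) \<Rightarrow>\<^sub>0 'k) \<longleftrightarrow> c = 0" for c
    by (metis lookup_single_eq lookup_zero single_zero)
  then have M_iff: "p \<in> ?M \<longleftrightarrow> p \<in> carrier ?S \<and> Poly_Mapping.lookup p 0 = 0" for p
    unfolding subst_kernel_def poly_subst_at_zero mem_Collect_eq by (simp only:)
  show ?thesis
  proof (rule maximalidealI[OF is_ideal I_notcarr])
    fix I assume I: "ideal I ?S" "?M \<subseteq> I" "I \<subseteq> carrier ?S"
    show "I = ?M \<or> I = carrier ?S"
    proof (cases "I = ?M")
      case False
      then obtain p where p: "p \<in> I" "p \<notin> ?M" using I(2) by blast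
      define c where "c = Poly_Mapping.lookup p 0"
      have pc: "p \<in> carrier ?S" using p I(3) by blast
      then have "c \<noteq> 0" using p(2) M_iff[of p] unfolding c_def by blast
      have "p - const c \<in> ?M" unfolding M_iff using pc
        by (simp add: c_def lookup_minus matrix_poly_ring_closed)
      then have "p - (p - const c) \<in> I" 
        using matrix_poly_ideal_closed(2)[OF I(1) p(1)] I(2) by blast
      then have "const c \<in> I" by simp
      then have "const (inverse c) * const c \<in> I"
        by (rule matrix_poly_ideal_closed(5)[OF I(1)]) simp
      then have "\<one>\<^bsub>?S\<^esub> \<in> I" using \<open>c \<noteq> 0\<close> by (simp add: mult_single)
      then show ?thesis using ideal.one_imp_carrier[OF I(1)] by blast
    qed simp
  qed
qed

lemma toric_kernel_below_origin:
  fixes V :: "'a set" and W :: "'b set"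
  shows "subst_kernel V W (toric_subst Z rep) \<subseteq>
    subst_kernel V W (\<lambda>_. 0 :: (('a, 'b) param \<Rightarrow>\<^sub>0 nat) \<Rightarrow>\<^sub>0 'k::field)"
proof
  fix p :: "('a, 'b, 'k) matrix_poly"
  assume p: "p \<in> subst_kernel V W (toric_subst Z rep)"
  let ?z = "\<lambda>_. 0 :: (('a, 'b) param \<Rightarrow>\<^sub>0 nat) \<Rightarrow>\<^sub>0 'k"
  have "poly_subst ?z (toric_subst Z rep x) = 0" for x :: "'a \<times> 'b"
    by (cases "snd x \<in> Z") (simp_all add: toric_subst_def poly_subst_mult)
  then have "poly_subst ?z p = poly_subst (\<lambda>x. poly_subst ?z (toric_subst Z rep x)) p" by simp
  also have "\<dots> = poly_subst ?z (poly_subst (toric_subst Z rep) p)" by (simp add: poly_subst_comp)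
  also have "\<dots> = 0" using p by (simp add: subst_kernel_def)
  finally show "p \<in> subst_kernel V W (\<lambda>_. 0 :: (('a, 'b) param \<Rightarrow>\<^sub>0 nat) \<Rightarrow>\<^sub>0 'k)"
    using p by (simp add: subst_kernel_def)
qed


section \<open>The two primes of different height\<close>

context edge_minors
begin

text \<open>The height of \<open>P\<close> is at least k. Every chain below \<open>Q\<close> is
  prolonged by the chain from \<open>Q\<close> to \<open>M\<close>, so the height of
  \<open>Q\<close> is at most |V||W| - d, and equal heights would force k + d <= |V||W|.\<close>

lemma not_unmixed_of_chains:
  assumes P: "primeideal P S" "\<exists>f\<in>carrier S. P = colon S J f"
    and Q: "primeideal Q S" "\<exists>f\<in>carrier S. Q = colon S J f"
    and below: "(P0, P) \<in> prime_step S ^^ k"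
    and above: "(Q, M) \<in> prime_step S ^^ d"
    and large: "card V * card W < k + d"
  shows "\<not> unmixed S J"
proof
  assume "unmixed S J"
  moreover have "P \<in> associated_primes S J" "Q \<in> associated_primes S J"
    using P Q unfolding associated_primes_def colon_def by auto
  ultimately have eq: "prime_height S P = prime_height S Q" unfolding unmixed_def by blast
  have "n + d \<le> card V * card W" if "(Q0, Q) \<in> prime_step S ^^ n" for n Q0
    using that above prime_chain_length_le[OF finite_V finite_W, of Q0 M "n + d"]
    by (auto simp: relpow_add)
  then have "n \<le> card V * card W - d" if "(Q0, Q) \<in> prime_step S ^^ n" for n Q0
    using that by fastforce
  then have "prime_height S Q \<le> enat (card V * card W - d)" by (rule prime_height_le)
  with prime_height_ge[OF below P(1)] eq have "enat k \<le> enat (card V * card W - d)"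
    by (simp only: order_trans)
  \<comment> \<open>Ensures that the subtraction of natural numbers above is not truncated.\<close>
  moreover have "d \<le> card V * card W"
    using prime_chain_length_le[OF finite_V finite_W above] .
  ultimately show False using large by simp
qed

text \<open>In S/J the image of \<open>M\<close> has height at least d, by the image of the chain
  above \<open>Q\<close>. Its depth is at most |V||W| - k: a regular sequence gives an equally long
  chain starting at the image of \<open>P\<close>, and the preimage of this chain is prolonged
  downwards by the one of length k.\<close>

lemma not_cohen_macaulay_of_chains:
  assumes P: "primeideal P S" "\<exists>f\<in>carrier S. P = colon S J f" "J \<subseteq> P" "P \<subseteq> M"
    and below: "(P0, P) \<in> prime_step S ^^ k"
    and above: "(Q, M) \<in> prime_step S ^^ d" and Q: "J \<subseteq> Q"
    and M: "maximalideal M S"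
    and large: "card V * card W < k + d"
  shows "\<not> cohen_macaulay (S Quot J)"
proof
  assume cm: "cohen_macaulay (S Quot J)"
  let ?R = "S Quot J"
  interpret S: cring S by (rule matrix_poly_ring_cring)
  interpret J: ideal J S by (rule J_ideal)
  interpret \<pi>: ring_hom_cring S ?R "(+>\<^bsub>S\<^esub>) J"
    by (rule J.rcos_ring_hom_cring[OF S.is_cring])
  let ?\<pi> = "(+>\<^bsub>S\<^esub>) J"
  have surj: "?\<pi> ` carrier S = carrier ?R"
    unfolding FactRing_def A_RCOSETS_def' by auto
  have zero_iff: "?\<pi> a = \<zero>\<^bsub>?R\<^esub> \<longleftrightarrow> a \<in> J" if "a \<in> carrier S" for a
    using that J.rcos_const_imp_mem J.a_rcos_const unfolding FactRing_def by auto
  have JM: "J \<subseteq> M" using P by blast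
  have kerP: "a \<in> P" and kerM: "a \<in> M" and kerQ: "a \<in> Q"
    if "a \<in> carrier S" "?\<pi> a = \<zero>\<^bsub>?R\<^esub>" for a
    using that zero_iff P JM Q by blast+
  have MR: "maximalideal (?\<pi> ` M) ?R" using \<pi>.image_maximal[OF surj M kerM] .
  have "enat d \<le> prime_height ?R (?\<pi> ` M)"
    using prime_height_ge[OF \<pi>.image_prime_chain[OF surj kerQ above]]
      \<pi>.image_prime[OF surj S.maximalideal_prime[OF M] kerM] by blast
  then have "enat d \<le> ideal_depth ?R (?\<pi> ` M)"
    using cm MR unfolding cohen_macaulay_def by simp
  moreover have "ideal_depth ?R (?\<pi> ` M) \<le> enat (card V * card W - k)"
    unfolding ideal_depth_def
  proof (rule Sup_least, clarify)
    fix xs assume xs: "set xs \<subseteq> ?\<pi> ` M" "regular_sequence ?R xs"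
    obtain f where f: "f \<in> carrier S" "P = colon S J f" using P(2) by blast
    \<comment> \<open>In the quotient the prime becomes the annihilator of the class of
      \<open>f\<close>, the form from which \<open>regular_sequence_prime_chain\<close>
      starts.\<close>
    have PR: "?\<pi> ` P = colon ?R {\<zero>\<^bsub>?R\<^esub>} (?\<pi> f)"
    proof -
      have "g \<in> P \<longleftrightarrow> ?\<pi> g \<otimes>\<^bsub>?R\<^esub> ?\<pi> f = \<zero>\<^bsub>?R\<^esub>" if g: "g \<in> carrier S" for g
      proof -
        have "?\<pi> g \<otimes>\<^bsub>?R\<^esub> ?\<pi> f = ?\<pi> (g \<otimes>\<^bsub>S\<^esub> f)" using g f(1) by (rule \<pi>.hom_mult[symmetric])
        then show ?thesis using zero_iff[of "g \<otimes>\<^bsub>S\<^esub> f"] S.m_closed[OF g f(1)] g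
          unfolding f(2) colon_def by auto
      qed
      moreover have "P \<subseteq> carrier S" unfolding f(2) colon_def by blast
      ultimately show ?thesis unfolding colon_def surj[symmetric] by blast
    qed
    have PM: "?\<pi> ` P \<subseteq> ?\<pi> ` M" using P(4) by blast
    have primeR: "primeideal (?\<pi> ` P) ?R" using \<pi>.image_prime[OF surj P(1) kerP] .
    \<comment> \<open>The Noetherian property of the quotient is part of the Cohen-Macaulay property
      assumed for contradiction.\<close>
    have noeth: "noetherian_ring ?R" using cm unfolding cohen_macaulay_def by blast
    obtain T where "(colon ?R {\<zero>\<^bsub>?R\<^esub>} (?\<pi> f), T) \<in> prime_step ?R ^^ length xs"
      using \<pi>.S.regular_sequence_prime_chain[OF noeth \<pi>.S.maximalideal_prime[OF MR] xs(2,1)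
          \<pi>.hom_closed[OF f(1)] primeR[unfolded PR] PM[unfolded PR]] by blast
    then have T: "(?\<pi> ` P, T) \<in> prime_step ?R ^^ length xs" unfolding PR .
    have "{r \<in> carrier S. ?\<pi> r \<in> ?\<pi> ` P} = P"
      using \<pi>.image_mem_iff[OF primeideal.axioms(1)[OF P(1)] kerP]
        ideal.Icarr[OF primeideal.axioms(1)[OF P(1)]] by blast
    with \<pi>.vimage_prime_chain[OF surj T]
    have "(P, {r \<in> carrier S. ?\<pi> r \<in> T}) \<in> prime_step S ^^ length xs" by simp
    with below have "(P0, {r \<in> carrier S. ?\<pi> r \<in> T}) \<in> prime_step S ^^ (k + length xs)"
      unfolding relpow_add by auto
    then have "k + length xs \<le> card V * card W"
      by (rule prime_chain_length_le[OF finite_V finite_W])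
    then show "enat (length xs) \<le> enat (card V * card W - k)" by simp
  qed
  ultimately have "enat d \<le> enat (card V * card W - k)" by (rule order_trans)
  then have "d \<le> card V * card W - k" by simp
  moreover have "k \<le> card V * card W"
    using prime_chain_length_le[OF finite_V finite_W below] .
  ultimately show False using large by linarith
qed

text \<open>\<open>W1\<close> carries the blocks, \<open>W2\<close> the columns set to zero. Every
  vertex of \<open>W2\<close> is joined to all of \<open>W1\<close>, hence to at least two blocks,
  which is the cut condition. The join also connects all of \<open>W\<close>, as the prime of all
  2-minors requires.\<close>

theorem join_not_unmixed_not_cohen_macaulay:
  assumes W: "W = W1 \<union> W2" "W1 \<inter> W2 = {}" "W2 \<noteq> {}"
    and join: "W1 \<times> W2 \<subseteq> E2" "W2 \<times> W1 \<subseteq> E2"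
    and rep: "\<And>t. t \<in> W1 \<Longrightarrow> rep t \<in> W1" "\<And>t. t \<in> W1 \<Longrightarrow> rep (rep t) = rep t"
    and edge: "\<And>t l. (t, l) \<in> E2 \<Longrightarrow> t \<in> W1 \<Longrightarrow> l \<in> W1 \<Longrightarrow> rep t = rep l"
    and conn: "\<And>t l. t \<in> W1 \<Longrightarrow> l \<in> W1 \<Longrightarrow> rep t = rep l \<Longrightarrow> (t, l) \<in> (E2 \<inter> W1 \<times> W1)\<^sup>*"
    and blocks: "card (rep ` W1) \<ge> 2"
    and large: "(card V - 1) * (card (rep ` W1) - 1) < card W2"
  shows "\<not> unmixed S J \<and> \<not> cohen_macaulay (S Quot J)"
proof -
  have fin: "finite W1" "finite W2" using W finite_W by auto
  have "W1 \<noteq> {}" using blocks by auto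
  then obtain v0 where v0: "v0 \<in> W1" by blast
  obtain w0 where w0: "w0 \<in> W2" using W(3) by blast
  have "V \<noteq> {}" using card_V by auto
  then obtain i0 where i0: "i0 \<in> V" by blast
  have J_sub: "J \<subseteq> toric_prime {} (\<lambda>_. v0)" "J \<subseteq> toric_prime W2 rep"
    using edge E2 W by (intro toric_prime_contains; blast)+
  have assoc0: "\<exists>f\<in>carrier S. toric_prime {} (\<lambda>_. v0) = colon S J f"
  proof (rule toric_prime_associated)
    fix t l assume "t \<in> W - {}" "l \<in> W - {}"
    then consider "t \<in> W1" "l \<in> W1" | "t \<in> W1" "l \<in> W2" | "t \<in> W2" "l \<in> W1" | "t \<in> W2" "l \<in> W2"
      using W(1) by blast
    then have "(t, l) \<in> E2\<^sup>*"
    proof cases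
      case 1
      then have "(t, w0) \<in> E2" "(w0, l) \<in> E2" using join w0 by auto
      then show ?thesis by (meson converse_rtrancl_into_rtrancl r_into_rtrancl)
    next
      case 4
      then have "(t, v0) \<in> E2" "(v0, l) \<in> E2" using join v0 by auto
      then show ?thesis by (meson converse_rtrancl_into_rtrancl r_into_rtrancl)
    qed (use join in auto)
    then show "(t, l) \<in> (E2 \<inter> (- {}) \<times> (- {}))\<^sup>*" by simp
  qed auto
  have W_diff: "W - W2 = W1" using W by blast
  have assocT: "\<exists>f\<in>carrier S. toric_prime W2 rep = colon S J f"
  proof (rule toric_prime_associated)
    fix t l assume "(t, l) \<in> E2" "t \<notin> W2" "l \<notin> W2"
    then show "rep t = rep l" using edge E2 W(1) by blast
  next
    fix t l assume "t \<in> W - W2" "l \<in> W - W2" "rep t = rep l"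
    then have "(t, l) \<in> (E2 \<inter> W1 \<times> W1)\<^sup>*" using conn W_diff by blast
    moreover have "E2 \<inter> W1 \<times> W1 \<subseteq> E2 \<inter> (- W2) \<times> (- W2)" using W(2) by blast
    ultimately show "(t, l) \<in> (E2 \<inter> (- W2) \<times> (- W2))\<^sup>*" using rtrancl_mono by blast
  next
    fix t assume "t \<in> W2 \<inter> W"
    moreover obtain a b where "a \<in> W1" "b \<in> W1" "rep a \<noteq> rep b"
    proof (rule ccontr)
      assume "\<not> thesis"
      then have "rep ` W1 \<subseteq> {rep v0}" using that v0 by blast
      then have "card (rep ` W1) \<le> 1" using card_mono[of "{rep v0}"] by simp
      then show False using blocks by simp
    qed
    ultimately show "\<exists>a\<in>W - W2. \<exists>b\<in>W - W2. rep a \<noteq> rep b \<and> (t, a) \<in> E2 \<and> (t, b) \<in> E2"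
      unfolding W_diff using join by blast
  qed
  \<comment> \<open>A generic rank one block is determined by row \<open>i0\<close> and the column
    of its representative, so its other entries can be freed; the columns of \<open>W2\<close> are
    freed entirely.\<close>
  define F where "F = V \<times> W2 \<union> (V - {i0}) \<times> (W1 - rep ` W1)"
  define k where "k = card F"
  define d where "d = card V + card W - 1"
  obtain P0 where below: "(P0, toric_prime W2 rep) \<in> prime_step S ^^ k"
  proof -
    have "\<exists>Q. (Q, toric_prime W2 rep) \<in> prime_step S ^^ card F"
    proof (rule toric_prime_below_chain[OF finite_V finite_W])
      show "F \<subseteq> V \<times> W" unfolding F_def using W(1) by blast
    next
      fix i v assume "(i, v) \<in> F" "v \<notin> W2"
      then have *: "v \<in> W1" "i \<noteq> i0" unfolding F_def by auto
      show "\<exists>i0\<in>V. \<exists>v0\<in>W. v0 \<notin> W2 \<and> rep v0 = rep v \<and> (i, v0) \<notin> F \<and> (i0, v) \<notin> F \<and> (i0, v0) \<notin> F"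
        using * i0 rep[OF *(1)] W \<open>v \<notin> W2\<close>
        by (intro bexI[of _ i0] bexI[of _ "rep v"]) (auto simp: F_def)
    qed
    then show ?thesis using that unfolding k_def by blast
  qed
  let ?M = "subst_kernel V W (\<lambda>_. 0 :: (('a, 'b) param \<Rightarrow>\<^sub>0 nat) \<Rightarrow>\<^sub>0 'k)"
  have above: "(toric_prime {} (\<lambda>_. v0), ?M) \<in> prime_step S ^^ d"
    unfolding d_def using toric_prime_above_chain[OF finite_V finite_W i0] v0 W(1) by blast
  \<comment> \<open>With n2 the size of \<open>W2\<close> and r the number of blocks, k + d - |V||W|
    equals n2 - (|V| - 1)(r - 1), which is positive by \<open>large\<close>. Passing to successors
    and differences removes the truncated subtractions.\<close>
  have kd: "card V * card W < k + d"
  proof -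
    have rep_sub: "rep ` W1 \<subseteq> W1" using rep by auto
    define r where "r = card (rep ` W1)"
    have r: "1 \<le> r" "r \<le> card W1" unfolding r_def using blocks card_mono[OF fin(1) rep_sub] by auto
    have "F = V \<times> W2 \<union> (V - {i0}) \<times> (W1 - rep ` W1)" "V \<times> W2 \<inter> (V - {i0}) \<times> (W1 - rep ` W1) = {}"
      using W(2) unfolding F_def by auto
    then have "k = card V * card W2 + (card V - 1) * (card W1 - r)"
      unfolding k_def r_def using fin finite_V i0 rep_sub
      by (simp add: card_Un_disjoint card_cartesian_product card_Diff_subset finite_subset)
    moreover have "card W = card W1 + card W2" using W fin by (simp add: card_Un_disjoint)
    moreover obtain m where m: "card V = Suc m" using card_V by (cases "card V") auto
    moreover obtain r' n' where "r = Suc r'" "card W1 = r + n'" using r by (metis Suc_le_D le_iff_add One_nat_def)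
    ultimately show ?thesis
      using large unfolding d_def r_def[symmetric] by (simp add: algebra_simps)
  qed
  have prime: "primeideal (toric_prime W2 rep) S" "primeideal (toric_prime {} (\<lambda>_. v0)) S"
    by (rule subst_kernel_prime)+
  have "\<not> unmixed S J"
    using not_unmixed_of_chains[OF prime(1) assocT prime(2) assoc0 below above kd] .
  moreover have "\<not> cohen_macaulay (S Quot J)"
    using not_cohen_macaulay_of_chains[OF prime(1) assocT J_sub(2) toric_kernel_below_origin below above J_sub(1)
        origin_maximal kd] .
  ultimately show ?thesis by blast
qed

end


section \<open>Joins of graphs\<close>

lemma (in pair_graph) reachable_imp_rtrancl: "u \<rightarrow>\<^sup>*\<^bsub>with_proj G\<^esub> v \<Longrightarrow> (u, v) \<in> (parcs G)\<^sup>*"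
  unfolding reachable_def by (simp add: rtrancl_on_rtranclI)

lemma (in pair_graph) connected_imp_rtrancl:
  assumes "connected (with_proj G)" "u \<in> pverts G" "v \<in> pverts G"
  shows "(u, v) \<in> (parcs G)\<^sup>*"
  using symmetric_connected_imp_strongly_connected[OF sym_arcs assms(1)] assms(2,3)
  by (auto simp: strongly_connected_def intro: reachable_imp_rtrancl)

text \<open>Names each component by a chosen vertex, the form in which blocks enter
  \<open>toric_subst\<close>. The choice is injective because components are nonempty and
  disjoint.\<close>

lemma (in pair_graph) component_representatives:
  obtains rep where "\<And>t. t \<in> pverts G \<Longrightarrow> rep t \<in> pverts G"
    "\<And>t. t \<in> pverts G \<Longrightarrow> rep (rep t) = rep t"
    "\<And>t l. (t, l) \<in> parcs G \<Longrightarrow> rep t = rep l"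
    "\<And>t l. t \<in> pverts G \<Longrightarrow> l \<in> pverts G \<Longrightarrow> rep t = rep l \<Longrightarrow> (t, l) \<in> (parcs G)\<^sup>*"
    "card (rep ` pverts G) = card sccs"
proof -
  define pick where "pick C = (SOME u. u \<in> C)" for C :: "'a set"
  define rep where "rep t = pick (scc_of t)" for t
  have rep_in: "rep t \<in> scc_of t" if "t \<in> pverts G" for t
    unfolding rep_def pick_def using in_scc_of_self[OF that] by (rule someI[of "\<lambda>u. u \<in> scc_of t"])
  have scc_sub: "scc_of t \<subseteq> pverts G" for t
    unfolding scc_of_def using reachable_in_verts by auto
  \<comment> \<open>Symmetric arcs make reachability an equivalence relation, with the components as
    its classes.\<close>
  have scc_eq: "scc_of t = scc_of l" if "t \<rightarrow>\<^sup>*\<^bsub>with_proj G\<^esub> l" for t l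
    using that symmetric_reachable[OF sym_arcs that] reachable_trans unfolding scc_of_def by blast
  show ?thesis
  proof (rule that)
    fix t assume t: "t \<in> pverts G"
    show "rep t \<in> pverts G" using rep_in[OF t] scc_sub by blast
    have "scc_of t = scc_of (rep t)" using rep_in[OF t] by (intro scc_eq) (simp add: scc_of_def)
    then show "rep (rep t) = rep t" unfolding rep_def by simp
  next
    fix t l assume "(t, l) \<in> parcs G"
    then have "t \<rightarrow>\<^sup>*\<^bsub>with_proj G\<^esub> l" by (intro reachable_adjI) simp
    then show "rep t = rep l" unfolding rep_def using scc_eq by simp
  next
    fix t l assume tl: "t \<in> pverts G" "l \<in> pverts G" "rep t = rep l"
    then have "t \<rightarrow>\<^sup>*\<^bsub>with_proj G\<^esub> rep t" "rep t \<rightarrow>\<^sup>*\<^bsub>with_proj G\<^esub> l"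
      using rep_in[of t] rep_in[of l] unfolding scc_of_def by auto
    then show "(t, l) \<in> (parcs G)\<^sup>*" using reachable_trans reachable_imp_rtrancl by blast
  next
    have "inj_on pick sccs_verts"
    proof (rule inj_onI, rule ccontr)
      fix C D assume CD: "C \<in> sccs_verts" "D \<in> sccs_verts" "pick C = pick D" "C \<noteq> D"
      then have "C \<noteq> {}" "D \<noteq> {}" unfolding sccs_verts_def by auto
      then have "pick C \<in> C" "pick D \<in> D" unfolding pick_def by (auto intro: someI_ex)
      then show False using sccs_verts_disjoint[OF CD(1,2,4)] CD(3) by auto
    qed
    moreover have "rep ` pverts G = pick ` sccs_verts"
      unfolding rep_def using sccs_verts_conv_scc_of by auto
    ultimately show "card (rep ` pverts G) = card sccs"
      using card_image card_sccs_verts by metis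
  qed
qed

lemma (in pair_graph) card_components_mult_le:
  assumes "\<And>c. c \<in> sccs \<Longrightarrow> m \<le> card (verts c)"
  shows "m * card sccs \<le> card (pverts G)"
proof -
  have fin: "finite (pverts G)" by (rule pair_finite_verts)
  have sub: "\<Union>sccs_verts \<subseteq> pverts G" using sccs_verts_subsets by auto
  have "card sccs * m = (\<Sum>C\<in>sccs_verts. m)" using card_sccs_verts by simp
  also have "\<dots> \<le> (\<Sum>C\<in>sccs_verts. card C)"
    using assms by (intro sum_mono) (auto simp: sccs_verts_conv)
  also have "\<dots> = card (\<Union>sccs_verts)"
    using sccs_verts_disjoint finite_subset[OF sccs_verts_subsets fin]
    by (intro card_Union_disjoint[symmetric]) (auto simp: pairwise_def disjnt_def)
  also have "\<dots> \<le> card (pverts G)" using card_mono[OF fin sub] .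
  finally show ?thesis by (simp add: mult.commute)
qed

lemma minor_swap: "minor j i t l = - minor i j t l" "minor i j l t = - minor i j t l"
  unfolding minor_def by (simp_all add: algebra_simps)

text \<open>Exchanging two rows or two columns only changes the sign of a minor, so the generators
  for ordered edges yield the minors of all arcs.\<close>

lemma edge_minors_binomial_edge_ideal:
  fixes G1 :: "'a::linorder pair_pre_digraph" and G2 :: "'b::linorder pair_pre_digraph"
  assumes G1: "pair_graph G1" "Digraph_Component.connected (with_proj G1)" "card (pverts G1) \<ge> 2"
    and fin: "finite (pverts G2)" and E2: "parcs G2 \<subseteq> pverts G2 \<times> pverts G2"
      "sym (parcs G2)" "\<And>t. (t, t) \<notin> parcs G2"
  shows "edge_minors (pverts G1) (pverts G2) (parcs G1) (parcs G2)
    (binomial_edge_ideal G1 G2 :: ('a, 'b, 'k::field) matrix_poly set)"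
proof -
  interpret G1: pair_graph G1 by fact
  let ?S = "matrix_poly_ring (pverts G1) (pverts G2) :: ('a, 'b, 'k) matrix_poly ring"
  interpret S: cring ?S by (rule matrix_poly_ring_cring)
  define A :: "('a, 'b, 'k) matrix_poly set" where
    "A = {minor i j t l | i j t l. (i, j) \<in> parcs G1 \<and> i < j \<and> (t, l) \<in> parcs G2 \<and> t < l}"
  have J: "binomial_edge_ideal G1 G2 = genideal ?S A"
    unfolding binomial_edge_ideal_def A_def minor_def matrix_var_variable ..
  have E1: "parcs G1 \<subseteq> pverts G1 \<times> pverts G1" using G1.wellformed' by auto
  have A: "A \<subseteq> carrier ?S" unfolding A_def using E1 E2(1) by fastforce
  have ideal: "ideal (genideal ?S A) ?S" using S.genideal_ideal[OF A] .
  have minor_in: "minor i j t l \<in> genideal ?S A" if ij: "(i, j) \<in> parcs G1" and tl: "(t, l) \<in> parcs G2" for i j t l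
  proof -
    note neg = matrix_poly_ideal_closed(3)[OF ideal]
    have base: "minor i j t l \<in> genideal ?S A"
      if "(i, j) \<in> parcs G1" "i < j" "(t, l) \<in> parcs G2" "t < l" for i j t l
      using that S.genideal_self[OF A] unfolding A_def by blast
    have row: "minor i j t l \<in> genideal ?S A" if tl: "(t, l) \<in> parcs G2" "t < l" for t l
    proof (cases "i < j")
      case False
      then have "j < i" using G1.pair_no_loops[OF ij] by auto
      then have "minor j i t l \<in> genideal ?S A" using base G1.arcs_symmetric[OF ij] tl by blast
      then show ?thesis using neg minor_swap(1)[of i j t l] by metis
    qed (use base ij tl in blast)
    show ?thesis
    proof (cases "t < l")
      case False
      then have "l < t" using E2(3) tl by (metis linorder_neqE)
      then have "minor i j l t \<in> genideal ?S A" using row E2(2) tl by (blast dest: symD)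
      then show ?thesis using neg minor_swap(2)[of i j t l] by metis
    qed (use row tl in blast)
  qed
  show ?thesis
  proof (rule edge_minors.intro)
    show "finite (pverts G1)" by (rule G1.pair_finite_verts)
    show "(i, j) \<in> (parcs G1)\<^sup>*" if "i \<in> pverts G1" "j \<in> pverts G1" for i j
      using G1.connected_imp_rtrancl[OF G1(2) that] .
    show "(i, i) \<notin> parcs G1" for i using G1.pair_no_loops by fastforce
    fix I assume I: "ideal I ?S"
      and minors: "\<And>i j t l. (i, j) \<in> parcs G1 \<Longrightarrow> (t, l) \<in> parcs G2 \<Longrightarrow> minor i j t l \<in> I"
    show "binomial_edge_ideal G1 G2 \<subseteq> I"
      unfolding J using minors by (intro S.genideal_minimal[OF I]) (auto simp: A_def)
  qed (use E1 fin E2 G1(3) ideal minor_in in \<open>simp_all add: J\<close>)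
qed

text \<open>The assumption \<open>rs\<close> turns the component sizes of \<open>H2\<close> into the
  inequality (m-1)(r-1) < |V(H2)| on which the comparison of chain lengths depends.\<close>

lemma join_not_unmixed_of_fewer_components:
  fixes G1 :: "'a::linorder pair_pre_digraph" and H1 H2 :: "'b::linorder pair_pre_digraph"
  assumes G1: "pair_graph G1" "Digraph_Component.connected (with_proj G1)" "card (pverts G1) \<ge> 2"
    and H: "pair_graph H1" "pair_graph H2" "pverts H1 \<inter> pverts H2 = {}"
    and r: "card (pre_digraph.sccs (with_proj H1)) \<ge> 2"
    and rs: "card (pre_digraph.sccs (with_proj H1)) \<le> card (pre_digraph.sccs (with_proj H2))"
    and size: "\<And>c. c \<in> pre_digraph.sccs (with_proj H2) \<Longrightarrow> card (pverts G1) \<le> card (verts c)"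
  defines "S \<equiv> matrix_poly_ring (pverts G1) (pverts (graph_join H1 H2)) :: ('a, 'b, 'k::field) matrix_poly ring"
    and "J \<equiv> binomial_edge_ideal G1 (graph_join H1 H2)"
  shows "\<not> unmixed S J \<and> \<not> cohen_macaulay (S Quot J)"
proof -
  interpret H1: pair_graph H1 by fact
  interpret H2: pair_graph H2 by fact
  let ?G = "graph_join H1 H2"
  have H1_sub: "parcs H1 \<subseteq> pverts H1 \<times> pverts H1" and H2_sub: "parcs H2 \<subseteq> pverts H2 \<times> pverts H2"
    using H1.wellformed' H2.wellformed' by auto
  have join: "pverts ?G = pverts H1 \<union> pverts H2"
    "parcs ?G = parcs H1 \<union> parcs H2 \<union> pverts H1 \<times> pverts H2 \<union> pverts H2 \<times> pverts H1"
    by (simp_all add: graph_join_def)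
  have "sym (parcs ?G)"
    unfolding join using H1.arcs_symmetric H2.arcs_symmetric by (intro symI) blast
  moreover have "(t, t) \<notin> parcs ?G" for t
    unfolding join using H1.pair_no_loops[of "(t, t)"] H2.pair_no_loops[of "(t, t)"] H(3) by auto
  ultimately interpret edge_minors "pverts G1" "pverts ?G" "parcs G1" "parcs ?G" J
    unfolding J_def using H1_sub H2_sub H1.pair_finite_verts H2.pair_finite_verts
    by (intro edge_minors_binomial_edge_ideal[OF G1]) (auto simp: join)
  obtain rep where rep: "\<And>t. t \<in> pverts H1 \<Longrightarrow> rep t \<in> pverts H1"
    "\<And>t. t \<in> pverts H1 \<Longrightarrow> rep (rep t) = rep t"
    "\<And>t l. (t, l) \<in> parcs H1 \<Longrightarrow> rep t = rep l"
    "\<And>t l. t \<in> pverts H1 \<Longrightarrow> l \<in> pverts H1 \<Longrightarrow> rep t = rep l \<Longrightarrow> (t, l) \<in> (parcs H1)\<^sup>*"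
    "card (rep ` pverts H1) = card (pre_digraph.sccs (with_proj H1))"
    by (rule H1.component_representatives) (rule that)
  let ?m = "card (pverts G1)" and ?r = "card (pre_digraph.sccs (with_proj H1))"
  have large: "(?m - 1) * (?r - 1) < card (pverts H2)"
  proof -
    have "(?m - 1) * (?r - 1) < ?m * ?r" using G1(3) r by (intro mult_strict_mono) auto
    also have "\<dots> \<le> ?m * card (pre_digraph.sccs (with_proj H2))" using rs by (rule mult_le_mono2)
    also have "\<dots> \<le> card (pverts H2)" using H2.card_components_mult_le[OF size] .
    finally show ?thesis .
  qed
  have edge: "rep t = rep l" if "(t, l) \<in> parcs ?G" "t \<in> pverts H1" "l \<in> pverts H1" for t l
    using that rep(3) H(3) H2_sub unfolding join by blast
  have conn: "(t, l) \<in> (parcs ?G \<inter> pverts H1 \<times> pverts H1)\<^sup>*"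
    if "t \<in> pverts H1" "l \<in> pverts H1" "rep t = rep l" for t l
  proof -
    have "parcs H1 \<subseteq> parcs ?G \<inter> pverts H1 \<times> pverts H1" using H1_sub unfolding join by blast
    then show ?thesis using rep(4)[OF that] rtrancl_mono by blast
  qed
  have ne: "pverts H2 \<noteq> {}" using large by auto
  have cross: "pverts H1 \<times> pverts H2 \<subseteq> parcs ?G" "pverts H2 \<times> pverts H1 \<subseteq> parcs ?G"
    unfolding join by auto
  have blocks: "card (rep ` pverts H1) \<ge> 2" "(?m - 1) * (card (rep ` pverts H1) - 1) < card (pverts H2)"
    using r large unfolding rep(5) by simp_all
  show ?thesis
    unfolding S_def
    by (rule join_not_unmixed_not_cohen_macaulay[where rep = rep and ?W1.0 = "pverts H1" and ?W2.0 = "pverts H2",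
          OF join(1) H(3) ne cross rep(1,2) edge conn blocks])
qed

lemma graph_join_commute: "graph_join G H = graph_join H G"
  by (auto simp: graph_join_def)

theorem corollary4p16:
  fixes G\<^sub>1 :: "'a::linorder pair_pre_digraph"
    and H\<^sub>1 H\<^sub>2 G\<^sub>2 :: "'b::linorder pair_pre_digraph"
    and C\<^sub>1 C\<^sub>2 :: "nat \<Rightarrow> 'b pair_pre_digraph"
    and m r s :: nat
    and S :: "('a, 'b, 'k::field) matrix_poly ring"
    and J :: "('a, 'b, 'k) matrix_poly set"
  assumes "pair_graph G\<^sub>1" and "Digraph_Component.connected (with_proj G\<^sub>1)"
    and "card (pverts G\<^sub>1) = m" and "m \<ge> 2"
    and "pair_graph H\<^sub>1" and "pair_graph H\<^sub>2" and "pverts H\<^sub>1 \<inter> pverts H\<^sub>2 = {}"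
    and "r \<ge> 2" and "bij_betw (\<lambda>i. with_proj (C\<^sub>1 i)) {1..r} (pre_digraph.sccs (with_proj H\<^sub>1))"
    and "s \<ge> 2" and "bij_betw (\<lambda>j. with_proj (C\<^sub>2 j)) {1..s} (pre_digraph.sccs (with_proj H\<^sub>2))"
    and "G\<^sub>2 = graph_join H\<^sub>1 H\<^sub>2"
    and "\<forall>i \<in> {1..r}. card (pverts (C\<^sub>1 i)) \<ge> m"
    and "\<forall>j \<in> {1..s}. card (pverts (C\<^sub>2 j)) \<ge> m"
    and "S = matrix_poly_ring (pverts G\<^sub>1) (pverts G\<^sub>2)"
    and "J = binomial_edge_ideal G\<^sub>1 G\<^sub>2"
  shows "\<not> unmixed S J \<and> \<not> cohen_macaulay (S Quot J)"
proof -
  have r: "card (pre_digraph.sccs (with_proj H\<^sub>1)) = r" and s: "card (pre_digraph.sccs (with_proj H\<^sub>2)) = s"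
    using bij_betw_same_card[OF assms(9)] bij_betw_same_card[OF assms(11)] by simp_all
  have size: "card (pverts G\<^sub>1) \<le> card (verts c)" if c: "c \<in> pre_digraph.sccs (with_proj H\<^sub>1)" for c
  proof -
    obtain i where "i \<in> {1..r}" "c = with_proj (C\<^sub>1 i)"
      using c bij_betw_imp_surj_on[OF assms(9)] by blast
    then show ?thesis using assms(3,13) by simp
  qed
  have size': "card (pverts G\<^sub>1) \<le> card (verts c)" if c: "c \<in> pre_digraph.sccs (with_proj H\<^sub>2)" for c
  proof -
    obtain i where "i \<in> {1..s}" "c = with_proj (C\<^sub>2 i)"
      using c bij_betw_imp_surj_on[OF assms(11)] by blast
    then show ?thesis using assms(3,14) by simp
  qed
  have m: "2 \<le> card (pverts G\<^sub>1)" using assms(3,4) by simp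
  show ?thesis
  \<comment> \<open>The join is commutative, so the factor with fewer components may be taken as the
    first one.\<close>
  proof (cases "r \<le> s")
    case True
    then show ?thesis
      using join_not_unmixed_of_fewer_components[OF assms(1,2) m assms(5-7) _ _ size', where 'k = 'k]
        r s assms(8,12,15,16) by simp
  next
    case False
    then show ?thesis
      using join_not_unmixed_of_fewer_components[OF assms(1,2) m assms(6,5) _ _ _ size, where 'k = 'k]
        r s assms(7,10,12,15,16) graph_join_commute[of H\<^sub>1 H\<^sub>2] by (simp add: Int_commute)
  qed
qed

end
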